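(* There is a natural $\mathbb Q(v)$-algebra isomorphism ${}^{\mathrm{DR}}\widetilde{\mathbf U}^{\imath}\cong{}^{\mathrm{Dr}}\widetilde{\mathbf U}^{\imath}[C^{\pm\frac12}]$, given by identifying $\widehat H_{i,m}=H_{i,m}C^{-\frac m2}$, $\widehat\Theta_{i,m}=\Theta_{i,m}C^{-\frac m2}$ ($i\in\mathbb I_0$, $m\ge1$) and identifying elements in the same notation ($\mathbb K_i^{\pm1}$, $C^{\pm\frac12}$, $B_{i,l}$).
   Context: $v$ is an indeterminate; algebras are unital associative over $\mathbb Q(v)$. $[n]=\frac{v^n-v^{-n}}{v-v^{-1}}$, $[A,B]_{v^a}=AB-v^aBA$, $[A,B]=AB-BA$. $(c_{ij})_{i,j\in\mathbb I_0}$ is the Cartan matrix of a simple Lie algebra of type ADE. The algebra ${}^{\mathrm{Dr}}\widetilde{\mathbf U}^{\imath}$ is generated by $\mathbb K_i^{\pm1},C^{\pm1},H_{i,m},B_{i,l}$ ($i\in\mathbb I_0$, $m\ge1$, $l\in\mathbb Z$) subject to, for $m,n\ge1$, $k,l,k_1,k_2\in\mathbb Z$, $i,j\in\mathbb I_0$: (1) $\mathbb K_i,C$ central, $[H_{i,m},H_{j,n}]=0$, $\mathbb K_i\mathbb K_i^{-1}=1$, $CC^{-1}=1$; (2) $[H_{i,m},B_{j,l}]=\frac{[mc_{ij}]}mB_{j,l+m}-\frac{[mc_{ij}]}mB_{j,l-m}C^m$; (3) $[B_{i,k},B_{j,l}]=0$ if $c_{ij}=0$; (4) $[B_{i,k},B_{j,l+1}]_{v^{-c_{ij}}}-v^{-c_{ij}}[B_{i,k+1},B_{j,l}]_{v^{c_{ij}}}=0$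 if $i\ne j$; (5) $[B_{i,k},B_{i,l+1}]_{v^{-2}}-v^{-2}[B_{i,k+1},B_{i,l}]_{v^2}=v^{-2}\Theta_{i,l-k+1}C^k\mathbb K_i-v^{-4}\Theta_{i,l-k-1}C^{k+1}\mathbb K_i+v^{-2}\Theta_{i,k-l+1}C^l\mathbb K_i-v^{-4}\Theta_{i,k-l-1}C^{l+1}\mathbb K_i$; (6) if $c_{ij}=-1$: $S(k_1,k_2|l)+S(k_2,k_1|l)=R(k_1,k_2|l)+R(k_2,k_1|l)$, where $S(k_1,k_2|l)=B_{i,k_1}B_{i,k_2}B_{j,l}-[2]B_{i,k_1}B_{j,l}B_{i,k_2}+B_{j,l}B_{i,k_1}B_{i,k_2}$ and $$R(k_1,k_2|l)=\mathbb K_iC^{k_1}\Big(-\sum_{p\ge0}v^{2p}[2][\Theta_{i,k_2-k_1-2p-1},B_{j,l-1}]_{v^{-2}}C^{p+1}-\sum_{p\ge1}v^{2p-1}[2][B_{j,l},\Theta_{i,k_2-k_1-2p}]_{v^{-2}}C^p-[B_{j,l},\Theta_{i,k_2-k_1}]_{v^{-2}}\Big).$$ Here $\Theta_{i,0}=(v-v^{-1})^{-1}$, $\Theta_{i,m}=0$ for $m<0$, and $1+\sum_{m\ge1}(v-v^{-1})\Theta_{i,m}u^m=\exp\big((v-v^{-1})\sum_{m\ge1}H_{i,m}u^m\big)$. Put ${}^{\mathrm{Dr}}\widetilde{\mathbf U}^{\imath}[C^{\pm\frac12}]={}^{\mathrm{Dr}}\widetilde{\mathbf U}^{\imath}\otimes_{\mathbb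 Q(v)[C^{\pm1}]}\mathbb Q(v)[C^{\pm\frac12}]$, where $(C^{\frac12})^2=C$. The algebra ${}^{\mathrm{DR}}\widetilde{\mathbf U}^{\imath}$ is generated by $\mathbb K_i^{\pm1},C^{\pm\frac12},\widehat H_{i,m},B_{i,l}$ ($i\in\mathbb I_0$, $m\ge1$, $l\in\mathbb Z$), with $\mathbb K_i\mathbb K_i^{-1}=1$, $C^{\frac12}C^{-\frac12}=1$, $C=(C^{\frac12})^2$, subject to, for $m,n\ge1$, $k,l,k_1,k_2\in\mathbb Z$, $i,j\in\mathbb I_0$: (1') $\mathbb K_i,C^{\pm\frac12}$ central, $[\widehat H_{i,m},\widehat H_{j,n}]=0$; (2') $[\widehat H_{i,m},B_{j,l}]=\frac{[mc_{ij}]}mB_{j,l+m}C^{-\frac m2}-\frac{[mc_{ij}]}mB_{j,l-m}C^{\frac m2}$; (3') $[B_{i,k},B_{j,l}]=0$ if $c_{ij}=0$; (4') $[B_{i,k},B_{j,l+1}]_{v^{-c_{ij}}}-v^{-c_{ij}}[B_{i,k+1},B_{j,l}]_{v^{c_{ij}}}=0$ if $i\ne j$; (5') $[B_{i,k},B_{i,l+1}]_{v^{-2}}-v^{-2}[B_{i,k+1},B_{i,l}]_{v^2}=\mathbb K_iC^{\frac{k+l+1}2}\big(v^{-2}\widehat\Theta_{i,l-k+1}-v^{-4}\widehat\Theta_{i,l-k-1}+v^{-2}\widehat\Theta_{i,k-l+1}-v^{-4}\widehat\Theta_{i,k-l-1}\big)$; (6') if $c_{ij}=-1$: $S(k_1,k_2|l)+S(k_2,k_1|l)=\widehat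 R(k_1,k_2|l)+\widehat R(k_2,k_1|l)$, where $S(k_1,k_2|l)=B_{i,k_1}B_{i,k_2}B_{j,l}-[2]B_{i,k_1}B_{j,l}B_{i,k_2}+B_{j,l}B_{i,k_1}B_{i,k_2}$ and $$\widehat R(k_1,k_2|l)=\mathbb K_iC^{\frac{k_1+k_2}2}\Big(-\sum_{p\ge0}v^{2p}[2][\widehat\Theta_{i,k_2-k_1-2p-1},B_{j,l-1}]_{v^{-2}}C^{\frac12}-\sum_{p\ge0}v^{2p-1}[2][B_{j,l},\widehat\Theta_{i,k_2-k_1-2p}]_{v^{-2}}+v^{-2}[B_{j,l},\widehat\Theta_{i,k_2-k_1}]_{v^{-2}}\Big).$$ Here $1+\sum_{m\ge1}(v-v^{-1})\widehat\Theta_{i,m}u^m=\exp\big((v-v^{-1})\sum_{m\ge1}\widehat H_{i,m}u^m\big)$, $\widehat\Theta_{i,0}=\frac1{v-v^{-1}}$, $\widehat\Theta_{i,m}=0$ for $m<0$. *)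

theory Defs
  imports
    "HOL-Library.Poly_Mapping"
    "HOL-Computational_Algebra.Polynomial_Factorial"
    "HOL-Computational_Algebra.Formal_Power_Series"
    "HOL-Algebra.QuotRing"
    "HOL-Algebra.Module"
    "HOL-Algebra.Algebraic_Closure_Type"
begin

section \<open>Unital associative algebras\<close>

lemma ring_type_algebra: "ring (ring_of_type_algebra :: 'a::ring_1 ring)"
proof -
  have "\<exists>y. x + y = 0" for x :: 'a
    using add.right_inverse by blast
  then show ?thesis
    unfolding ring_of_type_algebra_def using add.right_inverse
    by unfold_locales (auto simp: algebra_simps Units_def)
qed

lemma ring_of_type_algebra_simps [simp]:
  "carrier ring_of_type_algebra = UNIV"
  "x \<otimes>\<^bsub>ring_of_type_algebra\<^esub> y = x * y"
  "x \<oplus>\<^bsub>ring_of_type_algebra\<^esub> y = x + y"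
  "\<one>\<^bsub>ring_of_type_algebra\<^esub> = 1"
  "\<zero>\<^bsub>ring_of_type_algebra\<^esub> = 0"
  by (simp_all add: ring_of_type_algebra_def)

text \<open>The locale \<^locale>\<open>algebra\<close> of the library is restricted to commutative algebras.\<close>

locale assoc_algebra = module K A + A?: ring A for K (structure) and A (structure) +
  assumes smult_mult_left:
      "\<lbrakk>a \<in> carrier K; x \<in> carrier A; y \<in> carrier A\<rbrakk>
        \<Longrightarrow> (a \<odot>\<^bsub>A\<^esub> x) \<otimes>\<^bsub>A\<^esub> y = a \<odot>\<^bsub>A\<^esub> (x \<otimes>\<^bsub>A\<^esub> y)"
    and smult_mult_right:
      "\<lbrakk>a \<in> carrier K; x \<in> carrier A; y \<in> carrier A\<rbrakk>
        \<Longrightarrow> x \<otimes>\<^bsub>A\<^esub> (a \<odot>\<^bsub>A\<^esub> y) = a \<odot>\<^bsub>A\<^esub> (x \<otimes>\<^bsub>A\<^esub> y)"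

definition algebra_iso ::
  "('k, 'm) ring_scheme \<Rightarrow> ('k, 'a, 'n) module_scheme \<Rightarrow> ('k, 'b, 'p) module_scheme
    \<Rightarrow> ('a \<Rightarrow> 'b) set"
  where "algebra_iso K A B =
    {h \<in> ring_iso A B. \<forall>k\<in>carrier K. \<forall>x\<in>carrier A. h (k \<odot>\<^bsub>A\<^esub> x) = k \<odot>\<^bsub>B\<^esub> h x}"

text \<open>A ring homomorphism \<open>e\<close> from \<open>K\<close> to the centre of \<open>A\<close> makes \<open>A\<close> a \<open>K\<close>-algebra.\<close>

definition algebra_via :: "('a, 'm) ring_scheme \<Rightarrow> ('k \<Rightarrow> 'a) \<Rightarrow> ('k, 'a) module"
  where "algebra_via A e =
    \<lparr>carrier = carrier A, monoid.mult = monoid.mult A, one = \<one>\<^bsub>A\<^esub>, zero = \<zero>\<^bsub>A\<^esub>, add = add A,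
     module.smult = (\<lambda>k x. e k \<otimes>\<^bsub>A\<^esub> x)\<rparr>"

lemma assoc_algebra_via:
  assumes "cring K" "ring A" "e \<in> ring_hom K A"
    and "\<And>k x. k \<in> carrier K \<Longrightarrow> x \<in> carrier A \<Longrightarrow> e k \<otimes>\<^bsub>A\<^esub> x = x \<otimes>\<^bsub>A\<^esub> e k"
  shows "assoc_algebra K (algebra_via A e)"
proof -
  interpret K: cring K by fact
  interpret A: ring A by fact
  note e = ring_hom_closed[OF assms(3)] ring_hom_add[OF assms(3)] ring_hom_mult[OF assms(3)]
    ring_hom_one[OF assms(3)]
  have "ring (algebra_via A e)"
    by (intro ringI abelian_groupI monoidI)
      (auto simp: algebra_via_def A.m_assoc A.a_ac A.l_distr A.r_distr
        intro: A.a_inv_closed A.l_neg)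
  then interpret V: ring "algebra_via A e" .
  have comm: "x \<otimes>\<^bsub>A\<^esub> (e k \<otimes>\<^bsub>A\<^esub> y) = e k \<otimes>\<^bsub>A\<^esub> (x \<otimes>\<^bsub>A\<^esub> y)"
    if "k \<in> carrier K" "x \<in> carrier A" "y \<in> carrier A" for k x y
    using that e(1) assms(4)[of k x] A.m_assoc[of x "e k" y] A.m_assoc[of "e k" x y] by simp
  show ?thesis
    by (intro assoc_algebra.intro moduleI assoc_algebra_axioms.intro
        K.cring_axioms V.abelian_group_axioms V.ring_axioms)
      (simp_all add: algebra_via_def e A.l_distr A.r_distr A.m_assoc, rule comm)
qed


section \<open>Algebras presented by generators and relations\<close>

datatype 'g fmon = FMon (letters: "'g list")

instantiation fmon :: (type) monoid_add
begin
definition zero_fmon :: "'a fmon" where "0 = FMon []"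
definition plus_fmon :: "'a fmon \<Rightarrow> 'a fmon \<Rightarrow> 'a fmon"
  where "x + y = FMon (letters x @ letters y)"
instance by standard (simp_all add: zero_fmon_def plus_fmon_def)
end

text \<open>The monoid algebra of the free monoid (written additively) is the free algebra.\<close>

type_synonym ('g, 'k) free_alg = "'g fmon \<Rightarrow>\<^sub>0 'k"

definition letter :: "'g \<Rightarrow> ('g, 'k::field) free_alg"
  where "letter g = Poly_Mapping.single (FMon [g]) 1"

definition scalar :: "'k::field \<Rightarrow> ('g, 'k) free_alg"
  where "scalar k = Poly_Mapping.single 0 k"

text \<open>A relation \<open>rel x y\<close> stands for the identity \<open>x = y\<close>.\<close>

definition rel_ideal ::
  "(('g, 'k::field) free_alg \<Rightarrow> ('g, 'k) free_alg \<Rightarrow> bool) \<Rightarrow> ('g, 'k) free_alg set"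
  where "rel_ideal rel = genideal ring_of_type_algebra {x - y | x y. rel x y}"

definition coset ::
  "(('g, 'k::field) free_alg \<Rightarrow> ('g, 'k) free_alg \<Rightarrow> bool)
    \<Rightarrow> ('g, 'k) free_alg \<Rightarrow> ('g, 'k) free_alg set"
  where "coset rel x = rel_ideal rel +>\<^bsub>ring_of_type_algebra\<^esub> x"

definition presented_algebra ::
  "(('g, 'k::field) free_alg \<Rightarrow> ('g, 'k) free_alg \<Rightarrow> bool)
    \<Rightarrow> ('k, ('g, 'k) free_alg set) module"
  where "presented_algebra rel =
    algebra_via (ring_of_type_algebra Quot rel_ideal rel) (\<lambda>k. coset rel (scalar k))"

lemma scalar_mult_scalar: "scalar (a * b) = scalar a * scalar b"
  by (simp add: scalar_def mult_single)

lemma scalar_add: "scalar (a + b) = scalar a + scalar b"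
  by (simp add: scalar_def single_add)

lemma scalar_one: "scalar 1 = 1"
  by (simp add: scalar_def)

lemma sum_monomials:
  "(\<Sum>w\<in>Poly_Mapping.keys x. Poly_Mapping.single w (Poly_Mapping.lookup x w)) = x"
  by (rule poly_mapping_eqI) (simp add: lookup_sum lookup_single when_def in_keys_iff)

lemma scalar_central: "scalar k * x = x * (scalar k :: ('g, 'k::field) free_alg)"
proof -
  have "scalar k * Poly_Mapping.single w a = Poly_Mapping.single w a * scalar k"
    for w :: "'g fmon" and a :: 'k
    by (simp add: scalar_def mult_single mult.commute)
  then have "scalar k * (\<Sum>w\<in>Poly_Mapping.keys x. Poly_Mapping.single w (Poly_Mapping.lookup x w)) =
      (\<Sum>w\<in>Poly_Mapping.keys x. Poly_Mapping.single w (Poly_Mapping.lookup x w)) * scalar k"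
    by (simp add: sum_distrib_left sum_distrib_right del: sum_monomials)
  then show ?thesis
    by (simp only: sum_monomials)
qed

lemma ideal_rel_ideal: "ideal (rel_ideal rel) ring_of_type_algebra"
  unfolding rel_ideal_def by (intro ring.genideal_ideal ring_type_algebra) auto

lemma ring_presented: "ring (ring_of_type_algebra Quot rel_ideal rel)"
  by (intro ideal.quotient_is_ring ideal_rel_ideal)

lemma coset_ring_hom:
  "coset rel \<in> ring_hom ring_of_type_algebra (ring_of_type_algebra Quot rel_ideal rel)"
  using ideal.rcos_ring_hom[OF ideal_rel_ideal, of rel] by (simp add: coset_def[abs_def])

lemma coset_surj: "carrier (ring_of_type_algebra Quot rel_ideal rel) = range (coset rel)"
  by (auto simp: FactRing_def A_RCOSETS_def' coset_def)

lemma coset_eqI: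
  assumes "rel x y"
  shows "coset rel x = coset rel y"
proof -
  interpret I: ideal "rel_ideal rel" ring_of_type_algebra
    by (rule ideal_rel_ideal)
  have "x - y \<in> rel_ideal rel"
    unfolding rel_ideal_def using assms
    by (intro subsetD[OF ring.genideal_self[OF ring_type_algebra]]) auto
  then have "x \<in> rel_ideal rel +>\<^bsub>ring_of_type_algebra\<^esub> y"
    by (force simp: a_r_coset_def')
  then show ?thesis
    unfolding coset_def by (metis I.a_repr_independence I.a_subgroup ring_of_type_algebra_simps(1) UNIV_I)
qed

lemma coset_mult:
  "coset rel (x * y) = coset rel x \<otimes>\<^bsub>ring_of_type_algebra Quot rel_ideal rel\<^esub> coset rel y"
  using ring_hom_mult[OF coset_ring_hom, of x y rel] by simp

lemma coset_add:
  "coset rel (x + y) = coset rel x \<oplus>\<^bsub>ring_of_type_algebra Quot rel_ideal rel\<^esub> coset rel y"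
  using ring_hom_add[OF coset_ring_hom, of x y rel] by simp

lemma coset_one: "coset rel 1 = \<one>\<^bsub>ring_of_type_algebra Quot rel_ideal rel\<^esub>"
  using ring_hom_one[OF coset_ring_hom, of rel] by simp

lemma assoc_algebra_presented:
  fixes rel :: "('g, 'k::field) free_alg \<Rightarrow> ('g, 'k) free_alg \<Rightarrow> bool"
  shows "assoc_algebra (ring_of_type_algebra :: 'k ring) (presented_algebra rel)"
proof -
  have "(\<lambda>k. coset rel (scalar k)) \<in>
      ring_hom ring_of_type_algebra (ring_of_type_algebra Quot rel_ideal rel)"
    by (rule ring_hom_memI)
      (simp_all add: coset_surj scalar_mult_scalar scalar_add scalar_one coset_add coset_one coset_mult)
  moreover have "coset rel (scalar k) \<otimes>\<^bsub>ring_of_type_algebra Quot rel_ideal rel\<^esub> coset rel x =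
      coset rel x \<otimes>\<^bsub>ring_of_type_algebra Quot rel_ideal rel\<^esub> coset rel (scalar k)" for k x
    by (simp only: scalar_central flip: coset_mult)
  ultimately show ?thesis
    unfolding presented_algebra_def
    by (intro assoc_algebra_via ring_presented comm_ring_1_class.cring_from_type_algebra)
      (auto simp: coset_surj)
qed


section \<open>Tensor products of algebras\<close>

text \<open>The free abelian group on the pairs, with \<open>(a, b) (a', b') = (a a', b b')\<close>.\<close>

definition pair_ring ::
  "('a, 'm) ring_scheme \<Rightarrow> ('b, 'n) ring_scheme \<Rightarrow> ('a \<times> 'b \<Rightarrow>\<^sub>0 int) ring"
  where "pair_ring A B =
    \<lparr>carrier = {x. Poly_Mapping.keys x \<subseteq> carrier A \<times> carrier B},
     monoid.mult = (\<lambda>x y. frag_extend (\<lambda>(a, b). frag_extend (\<lambda>(a', b').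
       frag_of (a \<otimes>\<^bsub>A\<^esub> a', b \<otimes>\<^bsub>B\<^esub> b')) y) x),
     one = frag_of (\<one>\<^bsub>A\<^esub>, \<one>\<^bsub>B\<^esub>),
     zero = 0,
     add = (+)\<rparr>"

text \<open>
  Here \<open>A\<close> and \<open>B\<close> are algebras over the commutative ring \<open>R\<close>, with structure maps \<open>\<alpha>\<close> and \<open>\<beta>\<close>
  into their centres. The product of a pair with a relator is again a relator, so
  the ideal below is just the additive subgroup generated by the relators
  (lemma \<open>tensor_ideal_eq_generate\<close>), and the additive group
  of \<open>tensor_ring\<close> is the tensor product of the \<open>R\<close>-modules \<open>A\<close> and \<open>B\<close>.
\<close>

definition tensor_relators ::
  "('r, 'l) ring_scheme \<Rightarrow> ('r \<Rightarrow> 'a) \<Rightarrow> ('a, 'm) ring_scheme \<Rightarrow> ('r \<Rightarrow> 'b) \<Rightarrow> ('b, 'n) ring_scheme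
    \<Rightarrow> ('a \<times> 'b \<Rightarrow>\<^sub>0 int) set"
  where "tensor_relators R \<alpha> A \<beta> B =
    {frag_of (a \<oplus>\<^bsub>A\<^esub> a', b) - frag_of (a, b) - frag_of (a', b) | a a' b.
      a \<in> carrier A \<and> a' \<in> carrier A \<and> b \<in> carrier B} \<union>
    {frag_of (a, b \<oplus>\<^bsub>B\<^esub> b') - frag_of (a, b) - frag_of (a, b') | a b b'.
      a \<in> carrier A \<and> b \<in> carrier B \<and> b' \<in> carrier B} \<union>
    {frag_of (\<alpha> r \<otimes>\<^bsub>A\<^esub> a, b) - frag_of (a, \<beta> r \<otimes>\<^bsub>B\<^esub> b) | r a b.
      r \<in> carrier R \<and> a \<in> carrier A \<and> b \<in> carrier B}"

definition tensor_ideal ::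
  "('r, 'l) ring_scheme \<Rightarrow> ('r \<Rightarrow> 'a) \<Rightarrow> ('a, 'm) ring_scheme \<Rightarrow> ('r \<Rightarrow> 'b) \<Rightarrow> ('b, 'n) ring_scheme
    \<Rightarrow> ('a \<times> 'b \<Rightarrow>\<^sub>0 int) set"
  where "tensor_ideal R \<alpha> A \<beta> B = genideal (pair_ring A B) (tensor_relators R \<alpha> A \<beta> B)"

definition tensor_ring ::
  "('r, 'l) ring_scheme \<Rightarrow> ('r \<Rightarrow> 'a) \<Rightarrow> ('a, 'm) ring_scheme \<Rightarrow> ('r \<Rightarrow> 'b) \<Rightarrow> ('b, 'n) ring_scheme
    \<Rightarrow> ('a \<times> 'b \<Rightarrow>\<^sub>0 int) set ring"
  where "tensor_ring R \<alpha> A \<beta> B = pair_ring A B Quot tensor_ideal R \<alpha> A \<beta> B"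

definition pure_tensor ::
  "('r, 'l) ring_scheme \<Rightarrow> ('r \<Rightarrow> 'a) \<Rightarrow> ('a, 'm) ring_scheme \<Rightarrow> ('r \<Rightarrow> 'b) \<Rightarrow> ('b, 'n) ring_scheme
    \<Rightarrow> 'a \<Rightarrow> 'b \<Rightarrow> ('a \<times> 'b \<Rightarrow>\<^sub>0 int) set"
  where "pure_tensor R \<alpha> A \<beta> B a b =
    tensor_ideal R \<alpha> A \<beta> B +>\<^bsub>pair_ring A B\<^esub> frag_of (a, b)"

lemma frag_extend_diff_fun:
  fixes f g :: "'a \<Rightarrow> 'b \<Rightarrow>\<^sub>0 int"
  shows "frag_extend (\<lambda>p. f p - g p) x = frag_extend f x - frag_extend g x"
proof -
  have "frag_cmul k (a - b) = frag_cmul k a - frag_cmul k b" for k and a b :: "'b \<Rightarrow>\<^sub>0 int"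
    using frag_cmul_distrib2[of k a "- b"] frag_cmul_distrib2[of k b "- b"]
    by (simp add: eq_neg_iff_add_eq_0 algebra_simps)
  then show ?thesis
    by (simp add: frag_extend_def sum_subtractf)
qed

lemma pair_ring_simps:
  "x \<in> carrier (pair_ring A B) \<longleftrightarrow> Poly_Mapping.keys x \<subseteq> carrier A \<times> carrier B"
  "x \<oplus>\<^bsub>pair_ring A B\<^esub> y = x + y"
  "\<zero>\<^bsub>pair_ring A B\<^esub> = 0"
  "\<one>\<^bsub>pair_ring A B\<^esub> = frag_of (\<one>\<^bsub>A\<^esub>, \<one>\<^bsub>B\<^esub>)"
  by (simp_all add: pair_ring_def)

lemma pair_ring_mult_of:
  "frag_of (a, b) \<otimes>\<^bsub>pair_ring A B\<^esub> frag_of (a', b') = frag_of (a \<otimes>\<^bsub>A\<^esub> a', b \<otimes>\<^bsub>B\<^esub> b')"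
  by (simp add: pair_ring_def)

lemma pair_ring_mult_zero:
  "0 \<otimes>\<^bsub>pair_ring A B\<^esub> y = 0" "x \<otimes>\<^bsub>pair_ring A B\<^esub> 0 = 0"
  by (simp_all add: pair_ring_def frag_extend_eq_0 case_prod_unfold)

lemma pair_ring_mult_diff:
  "(x - x') \<otimes>\<^bsub>pair_ring A B\<^esub> y = x \<otimes>\<^bsub>pair_ring A B\<^esub> y - x' \<otimes>\<^bsub>pair_ring A B\<^esub> y"
  "x \<otimes>\<^bsub>pair_ring A B\<^esub> (y - y') = x \<otimes>\<^bsub>pair_ring A B\<^esub> y - x \<otimes>\<^bsub>pair_ring A B\<^esub> y'"
  by (simp_all add: pair_ring_def frag_extend_diff frag_extend_diff_fun case_prod_unfold)

lemma pair_ring_mult_add: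
  "(x + x') \<otimes>\<^bsub>pair_ring A B\<^esub> y = x \<otimes>\<^bsub>pair_ring A B\<^esub> y + x' \<otimes>\<^bsub>pair_ring A B\<^esub> y"
  "x \<otimes>\<^bsub>pair_ring A B\<^esub> (y + y') = x \<otimes>\<^bsub>pair_ring A B\<^esub> y + x \<otimes>\<^bsub>pair_ring A B\<^esub> y'"
  using pair_ring_mult_diff(1)[where x = x and x' = "- x'" and A = A and B = B and y = y] pair_ring_mult_diff(1)[where x = 0 and x' = x' and A = A and B = B and y = y]
    pair_ring_mult_diff(2)[where x = x and y = y and A = A and B = B and y' = "- y'"] pair_ring_mult_diff(2)[where x = x and y = 0 and A = A and B = B and y' = y']
  by (simp_all add: pair_ring_mult_zero)

lemma ring_pair_ring:
  assumes "ring A" "ring B"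
  shows "ring (pair_ring A B)"
proof -
  interpret A: ring A by fact
  interpret B: ring B by fact
  let ?P = "pair_ring A B"
  let ?S = "carrier A \<times> carrier B"
  have keys_diff_subset: "Poly_Mapping.keys (x - y) \<subseteq> ?S"
    if "Poly_Mapping.keys x \<subseteq> ?S" "Poly_Mapping.keys y \<subseteq> ?S" for x y :: "_ \<Rightarrow>\<^sub>0 int"
    using that keys_diff[of x y] by blast
  have keys_add_subset: "Poly_Mapping.keys (x + y) \<subseteq> ?S"
    if "Poly_Mapping.keys x \<subseteq> ?S" "Poly_Mapping.keys y \<subseteq> ?S" for x y :: "_ \<Rightarrow>\<^sub>0 int"
    using that Poly_Mapping.keys_add[of x y] by blast
  have closed: "Poly_Mapping.keys (x \<otimes>\<^bsub>?P\<^esub> y) \<subseteq> ?S"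
    if "Poly_Mapping.keys x \<subseteq> ?S" "Poly_Mapping.keys y \<subseteq> ?S" for x y
    using that(1)
  proof (induction x rule: frag_induction)
    case (one p)
    show ?case using that(2)
    proof (induction y rule: frag_induction)
      case (one q)
      then show ?case using \<open>p \<in> ?S\<close> by (cases p; cases q) (auto simp: pair_ring_mult_of)
    next
      case (diff a b)
      then show ?case by (simp add: pair_ring_mult_diff keys_diff_subset)
    qed (simp add: pair_ring_mult_zero)
  next
    case (diff a b)
    then show ?case by (simp add: pair_ring_mult_diff keys_diff_subset)
  qed (simp add: pair_ring_mult_zero)
  have assoc: "x \<otimes>\<^bsub>?P\<^esub> y \<otimes>\<^bsub>?P\<^esub> z = x \<otimes>\<^bsub>?P\<^esub> (y \<otimes>\<^bsub>?P\<^esub> z)"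
    if "Poly_Mapping.keys x \<subseteq> ?S" "Poly_Mapping.keys y \<subseteq> ?S" "Poly_Mapping.keys z \<subseteq> ?S"
    for x y z
    using that(1)
  proof (induction x rule: frag_induction)
    case (one p)
    show ?case using that(2)
    proof (induction y rule: frag_induction)
      case (one q)
      show ?case using that(3)
      proof (induction z rule: frag_induction)
        case (one r)
        then show ?case using \<open>p \<in> ?S\<close> \<open>q \<in> ?S\<close>
          by (cases p; cases q; cases r) (auto simp: pair_ring_mult_of A.m_assoc B.m_assoc)
      qed (simp_all add: pair_ring_mult_zero pair_ring_mult_diff)
    qed (simp_all add: pair_ring_mult_zero pair_ring_mult_diff)
  qed (simp_all add: pair_ring_mult_zero pair_ring_mult_diff)
  have one: "\<one>\<^bsub>?P\<^esub> \<otimes>\<^bsub>?P\<^esub> x = x \<and> x \<otimes>\<^bsub>?P\<^esub> \<one>\<^bsub>?P\<^esub> = x" if "Poly_Mapping.keys x \<subseteq> ?S" for x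
    using that
    by (induction x rule: frag_induction)
      (auto simp: pair_ring_mult_zero pair_ring_mult_diff pair_ring_mult_of pair_ring_simps)
  have one_closed: "Poly_Mapping.keys \<one>\<^bsub>?P\<^esub> \<subseteq> ?S"
    by (simp add: pair_ring_simps)
  have inv: "\<exists>y. Poly_Mapping.keys y \<subseteq> ?S \<and> x + y = 0" if "Poly_Mapping.keys x \<subseteq> ?S" for x :: "_ \<Rightarrow>\<^sub>0 int"
    using that by (intro exI[of _ "- x"]) auto
  show ?thesis
    apply (intro ringI abelian_groupI monoidI; unfold pair_ring_simps(1-3))
                apply (simp_all only: keys_add_subset closed assoc one one_closed pair_ring_mult_add)
        apply (simp_all add: add.assoc add.commute Bex_def pair_ring_simps(1) inv)
    done
qed

lemma tensor_relators_subset: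
  assumes "ring A" "ring B"
    and "\<And>r. r \<in> carrier R \<Longrightarrow> \<alpha> r \<in> carrier A" "\<And>r. r \<in> carrier R \<Longrightarrow> \<beta> r \<in> carrier B"
  shows "tensor_relators R \<alpha> A \<beta> B \<subseteq> carrier (pair_ring A B)"
proof -
  interpret A: ring A by fact
  interpret B: ring B by fact
  have *: "x - y \<in> carrier (pair_ring A B)"
    if "x \<in> carrier (pair_ring A B)" "y \<in> carrier (pair_ring A B)" for x y
    using that keys_diff[of x y] unfolding pair_ring_simps by blast
  have **: "frag_of (a, b) \<in> carrier (pair_ring A B)"
    if "a \<in> carrier A" "b \<in> carrier B" for a b
    using that by (simp add: pair_ring_simps)
  show ?thesis
    unfolding tensor_relators_def by (auto intro!: * ** simp: assms(3,4))
qed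

locale tensor_factors = A?: ring A + B?: ring B
  for R :: "('r, 'l) ring_scheme" and \<alpha> :: "'r \<Rightarrow> 'a" and A :: "('a, 'm) ring_scheme" (structure)
    and \<beta> :: "'r \<Rightarrow> 'b" and B :: "('b, 'n) ring_scheme" (structure) +
  assumes \<alpha>_closed: "r \<in> carrier R \<Longrightarrow> \<alpha> r \<in> carrier A"
    and \<alpha>_central: "r \<in> carrier R \<Longrightarrow> a \<in> carrier A \<Longrightarrow> \<alpha> r \<otimes>\<^bsub>A\<^esub> a = a \<otimes>\<^bsub>A\<^esub> \<alpha> r"
    and \<beta>_closed: "r \<in> carrier R \<Longrightarrow> \<beta> r \<in> carrier B"
    and \<beta>_central: "r \<in> carrier R \<Longrightarrow> b \<in> carrier B \<Longrightarrow> \<beta> r \<otimes>\<^bsub>B\<^esub> b = b \<otimes>\<^bsub>B\<^esub> \<beta> r"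
begin

abbreviation "P \<equiv> pair_ring A B"
abbreviation "rels \<equiv> tensor_relators R \<alpha> A \<beta> B"

lemma ring_P: "ring P"
  by (intro ring_pair_ring A.ring_axioms B.ring_axioms)

lemma rels_subset: "rels \<subseteq> carrier P"
  by (intro tensor_relators_subset A.ring_axioms B.ring_axioms \<alpha>_closed \<beta>_closed)

lemma relator_cases:
  assumes "z \<in> rels"
  obtains
    (left) a a' b where "a \<in> carrier A" "a' \<in> carrier A" "b \<in> carrier B"
      "z = frag_of (a \<oplus>\<^bsub>A\<^esub> a', b) - frag_of (a, b) - frag_of (a', b)"
  | (right) a b b' where "a \<in> carrier A" "b \<in> carrier B" "b' \<in> carrier B"
      "z = frag_of (a, b \<oplus>\<^bsub>B\<^esub> b') - frag_of (a, b) - frag_of (a, b')"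
  | (scalar) r a b where "r \<in> carrier R" "a \<in> carrier A" "b \<in> carrier B"
      "z = frag_of (\<alpha> r \<otimes>\<^bsub>A\<^esub> a, b) - frag_of (a, \<beta> r \<otimes>\<^bsub>B\<^esub> b)"
  using assms unfolding tensor_relators_def
  by (elim UnE CollectE exE conjE) (rule that; assumption)+

lemma relator_intros:
  "a \<in> carrier A \<Longrightarrow> a' \<in> carrier A \<Longrightarrow> b \<in> carrier B \<Longrightarrow>
    frag_of (a \<oplus>\<^bsub>A\<^esub> a', b) - frag_of (a, b) - frag_of (a', b) \<in> rels"
  "a \<in> carrier A \<Longrightarrow> b \<in> carrier B \<Longrightarrow> b' \<in> carrier B \<Longrightarrow>
    frag_of (a, b \<oplus>\<^bsub>B\<^esub> b') - frag_of (a, b) - frag_of (a, b') \<in> rels"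
  "r \<in> carrier R \<Longrightarrow> a \<in> carrier A \<Longrightarrow> b \<in> carrier B \<Longrightarrow>
    frag_of (\<alpha> r \<otimes>\<^bsub>A\<^esub> a, b) - frag_of (a, \<beta> r \<otimes>\<^bsub>B\<^esub> b) \<in> rels"
  unfolding tensor_relators_def
  by (rule UnI1, rule UnI1, blast) (rule UnI1, rule UnI2, blast, rule UnI2, blast)

lemma relator_mult_left:
  assumes "z \<in> rels" "c \<in> carrier A" "d \<in> carrier B"
  shows "frag_of (c, d) \<otimes>\<^bsub>P\<^esub> z \<in> rels"
  using assms(1)
proof (cases rule: relator_cases)
  case (left a a' b)
  then show ?thesis
    using relator_intros(1)[of "c \<otimes>\<^bsub>A\<^esub> a" "c \<otimes>\<^bsub>A\<^esub> a'" "d \<otimes>\<^bsub>B\<^esub> b"] assms(2,3)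
    by (simp add: pair_ring_mult_diff pair_ring_mult_of A.r_distr)
next
  case (right a b b')
  then show ?thesis
    using relator_intros(2)[of "c \<otimes>\<^bsub>A\<^esub> a" "d \<otimes>\<^bsub>B\<^esub> b" "d \<otimes>\<^bsub>B\<^esub> b'"] assms(2,3)
    by (simp add: pair_ring_mult_diff pair_ring_mult_of B.r_distr)
next
  case (scalar r a b)
  have "c \<otimes>\<^bsub>A\<^esub> (\<alpha> r \<otimes>\<^bsub>A\<^esub> a) = c \<otimes>\<^bsub>A\<^esub> \<alpha> r \<otimes>\<^bsub>A\<^esub> a"
    using scalar(1,2) assms(2) by (simp add: A.m_assoc \<alpha>_closed)
  also have "\<dots> = \<alpha> r \<otimes>\<^bsub>A\<^esub> c \<otimes>\<^bsub>A\<^esub> a"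
    using scalar(1) assms(2) by (simp only: \<alpha>_central)
  also have "\<dots> = \<alpha> r \<otimes>\<^bsub>A\<^esub> (c \<otimes>\<^bsub>A\<^esub> a)"
    using scalar(1,2) assms(2) by (simp add: A.m_assoc \<alpha>_closed)
  finally have 1: "c \<otimes>\<^bsub>A\<^esub> (\<alpha> r \<otimes>\<^bsub>A\<^esub> a) = \<alpha> r \<otimes>\<^bsub>A\<^esub> (c \<otimes>\<^bsub>A\<^esub> a)" .
  have "d \<otimes>\<^bsub>B\<^esub> (\<beta> r \<otimes>\<^bsub>B\<^esub> b) = d \<otimes>\<^bsub>B\<^esub> \<beta> r \<otimes>\<^bsub>B\<^esub> b"
    using scalar(1,3) assms(3) by (simp add: B.m_assoc \<beta>_closed)
  also have "\<dots> = \<beta> r \<otimes>\<^bsub>B\<^esub> d \<otimes>\<^bsub>B\<^esub> b"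
    using scalar(1) assms(3) by (simp only: \<beta>_central)
  also have "\<dots> = \<beta> r \<otimes>\<^bsub>B\<^esub> (d \<otimes>\<^bsub>B\<^esub> b)"
    using scalar(1,3) assms(3) by (simp add: B.m_assoc \<beta>_closed)
  finally have 2: "d \<otimes>\<^bsub>B\<^esub> (\<beta> r \<otimes>\<^bsub>B\<^esub> b) = \<beta> r \<otimes>\<^bsub>B\<^esub> (d \<otimes>\<^bsub>B\<^esub> b)" .
  have "frag_of (c, d) \<otimes>\<^bsub>P\<^esub> z =
      frag_of (\<alpha> r \<otimes>\<^bsub>A\<^esub> (c \<otimes>\<^bsub>A\<^esub> a), d \<otimes>\<^bsub>B\<^esub> b) - frag_of (c \<otimes>\<^bsub>A\<^esub> a, \<beta> r \<otimes>\<^bsub>B\<^esub> (d \<otimes>\<^bsub>B\<^esub> b))"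
    by (simp only: scalar(4) pair_ring_mult_diff pair_ring_mult_of 1 2)
  then show ?thesis
    using relator_intros(3)[of r "c \<otimes>\<^bsub>A\<^esub> a" "d \<otimes>\<^bsub>B\<^esub> b"] assms(2,3) scalar(1-3) by simp
qed

lemma relator_mult_right:
  assumes "z \<in> rels" "c \<in> carrier A" "d \<in> carrier B"
  shows "z \<otimes>\<^bsub>P\<^esub> frag_of (c, d) \<in> rels"
  using assms(1)
proof (cases rule: relator_cases)
  case (left a a' b)
  then show ?thesis
    using relator_intros(1)[of "a \<otimes>\<^bsub>A\<^esub> c" "a' \<otimes>\<^bsub>A\<^esub> c" "b \<otimes>\<^bsub>B\<^esub> d"] assms(2,3)
    by (simp add: pair_ring_mult_diff pair_ring_mult_of A.l_distr)
next
  case (right a b b')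
  then show ?thesis
    using relator_intros(2)[of "a \<otimes>\<^bsub>A\<^esub> c" "b \<otimes>\<^bsub>B\<^esub> d" "b' \<otimes>\<^bsub>B\<^esub> d"] assms(2,3)
    by (simp add: pair_ring_mult_diff pair_ring_mult_of B.l_distr)
next
  case (scalar r a b)
  then show ?thesis
    using relator_intros(3)[of r "a \<otimes>\<^bsub>A\<^esub> c" "b \<otimes>\<^bsub>B\<^esub> d"] assms(2,3)
    by (simp add: pair_ring_mult_diff pair_ring_mult_of A.m_assoc B.m_assoc \<alpha>_closed \<beta>_closed)
qed

lemma tensor_ideal_eq_generate: "tensor_ideal R \<alpha> A \<beta> B = generate (add_monoid P) rels"
proof -
  interpret P: ring P by (rule ring_P)
  define G where "G = generate (add_monoid P) rels"
  have sub: "subgroup G (add_monoid P)"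
    unfolding G_def using P.add.generate_is_subgroup rels_subset by blast
  have a_inv_eq: "\<ominus>\<^bsub>P\<^esub> x = - x" if "x \<in> carrier P" for x
    using that by (intro P.minus_equality) (simp_all add: pair_ring_simps)
  have diff: "x - y \<in> G" if "x \<in> G" "y \<in> G" for x y
  proof -
    have "y \<in> carrier P"
      using subgroup.subset[OF sub] that(2) by auto
    then have "- y \<in> G"
      using subgroup.m_inv_closed[OF sub that(2)] a_inv_eq[of y] by (simp add: a_inv_def)
    then show ?thesis
      using subgroup.m_closed[OF sub that(1), of "- y"] by (simp add: pair_ring_simps)
  qed
  have zero: "0 \<in> G"
    using subgroup.one_closed[OF sub] by (simp add: pair_ring_simps)
  have gen: "x \<in> rels \<Longrightarrow> x \<in> G" for x
    unfolding G_def by (rule generate.incl)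
  have add: "x + y \<in> G" if "x \<in> G" "y \<in> G" for x y
    using subgroup.m_closed[OF sub that] by (simp add: pair_ring_simps)
  have single: "frag_of p \<otimes>\<^bsub>P\<^esub> g \<in> G \<and> g \<otimes>\<^bsub>P\<^esub> frag_of p \<in> G"
    if "g \<in> G" "p \<in> carrier A \<times> carrier B" for g p
    using that(1)[unfolded G_def]
  proof (induction g rule: generate.induct)
    case one
    then show ?case using zero by (simp add: pair_ring_simps pair_ring_mult_zero)
  next
    case (incl h)
    then show ?case
      using that(2) gen relator_mult_left relator_mult_right by (cases p) auto
  next
    case (inv h)
    have "inv\<^bsub>add_monoid P\<^esub> h = 0 - h"
      using rels_subset a_inv_eq[of h] inv by (auto simp: a_inv_def)
    then show ?case
      using inv that(2) gen relator_mult_left relator_mult_right diff[OF zero]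
      by (cases p) (auto simp only: pair_ring_mult_diff pair_ring_mult_zero mem_Times_iff fst_conv snd_conv)
  next
    case (eng h1 h2)
    then show ?case
      using add by (simp add: pair_ring_simps pair_ring_mult_add)
  qed
  have mult: "x \<otimes>\<^bsub>P\<^esub> g \<in> G \<and> g \<otimes>\<^bsub>P\<^esub> x \<in> G" if "g \<in> G" "x \<in> carrier P" for g x
    using that(2) unfolding pair_ring_simps
    by (induction x rule: frag_induction)
      (auto simp: pair_ring_mult_zero pair_ring_mult_diff single[OF that(1)] zero intro: diff)
  have "ideal G P"
    by (intro idealI ring_P sub) (use mult in auto)
  then have "tensor_ideal R \<alpha> A \<beta> B \<subseteq> G"
    unfolding tensor_ideal_def by (intro P.genideal_minimal) (auto intro: gen)
  moreover have "G \<subseteq> tensor_ideal R \<alpha> A \<beta> B"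
  proof -
    have "ideal (tensor_ideal R \<alpha> A \<beta> B) P"
      unfolding tensor_ideal_def by (rule P.genideal_ideal[OF rels_subset])
    then have "subgroup (tensor_ideal R \<alpha> A \<beta> B) (add_monoid P)"
      by (simp add: ideal_def additive_subgroup_def)
    then show ?thesis
      unfolding tensor_ideal_def G_def
      by (intro P.add.generate_subgroup_incl P.genideal_self rels_subset)
  qed
  ultimately show ?thesis by (simp add: G_def)
qed

lemma ideal_tensor_ideal: "ideal (tensor_ideal R \<alpha> A \<beta> B) P"
  unfolding tensor_ideal_def by (intro ring.genideal_ideal ring_P rels_subset)

lemma ring_tensor_ring: "ring (tensor_ring R \<alpha> A \<beta> B)"
  unfolding tensor_ring_def by (intro ideal.quotient_is_ring ideal_tensor_ideal)

abbreviation "T \<equiv> tensor_ring R \<alpha> A \<beta> B"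
abbreviation "pure \<equiv> pure_tensor R \<alpha> A \<beta> B"

lemma tensor_coset_hom: "(\<lambda>x. tensor_ideal R \<alpha> A \<beta> B +>\<^bsub>P\<^esub> x) \<in> ring_hom P T"
  unfolding tensor_ring_def by (rule ideal.rcos_ring_hom[OF ideal_tensor_ideal])

lemma tensor_carrier: "carrier T = (\<lambda>x. tensor_ideal R \<alpha> A \<beta> B +>\<^bsub>P\<^esub> x) ` carrier P"
  by (auto simp: tensor_ring_def FactRing_def A_RCOSETS_def')

lemma frag_of_closed: "a \<in> carrier A \<Longrightarrow> b \<in> carrier B \<Longrightarrow> frag_of (a, b) \<in> carrier P"
  by (simp add: pair_ring_simps)

lemma pure_closed: "a \<in> carrier A \<Longrightarrow> b \<in> carrier B \<Longrightarrow> pure a b \<in> carrier T"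
  unfolding pure_tensor_def by (rule ring_hom_closed[OF tensor_coset_hom frag_of_closed])

lemma pure_mult:
  "\<lbrakk>a \<in> carrier A; b \<in> carrier B; a' \<in> carrier A; b' \<in> carrier B\<rbrakk>
    \<Longrightarrow> pure a b \<otimes>\<^bsub>T\<^esub> pure a' b' = pure (a \<otimes>\<^bsub>A\<^esub> a') (b \<otimes>\<^bsub>B\<^esub> b')"
  unfolding pure_tensor_def pair_ring_mult_of[symmetric]
  by (rule ring_hom_mult[OF tensor_coset_hom, symmetric]; simp add: frag_of_closed)

lemma pure_one: "pure \<one>\<^bsub>A\<^esub> \<one>\<^bsub>B\<^esub> = \<one>\<^bsub>T\<^esub>"
  using ring_hom_one[OF tensor_coset_hom] by (simp add: pure_tensor_def pair_ring_simps)

lemma tensor_coset_eqI: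
  assumes "x \<in> carrier P" "y \<in> carrier P" "x - y \<in> rels"
  shows "tensor_ideal R \<alpha> A \<beta> B +>\<^bsub>P\<^esub> x = tensor_ideal R \<alpha> A \<beta> B +>\<^bsub>P\<^esub> y"
proof -
  interpret I: ideal "tensor_ideal R \<alpha> A \<beta> B" P
    by (rule ideal_tensor_ideal)
  have "x - y \<in> tensor_ideal R \<alpha> A \<beta> B"
    unfolding tensor_ideal_eq_generate by (rule generate.incl[OF assms(3)])
  then have "x \<in> tensor_ideal R \<alpha> A \<beta> B +>\<^bsub>P\<^esub> y"
    by (force simp: a_r_coset_def' pair_ring_simps)
  then show ?thesis
    using I.a_repr_independence[OF _ assms(2) I.a_subgroup] by simp
qed

lemma pure_add_left:
  assumes "a \<in> carrier A" "a' \<in> carrier A" "b \<in> carrier B"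
  shows "pure (a \<oplus>\<^bsub>A\<^esub> a') b = pure a b \<oplus>\<^bsub>T\<^esub> pure a' b"
proof -
  interpret P: ring P by (rule ring_P)
  have "frag_of (a, b) + frag_of (a', b) \<in> carrier P"
    using P.a_closed[OF frag_of_closed frag_of_closed, of a b a' b] assms
    by (simp add: pair_ring_simps(2))
  then have "pure (a \<oplus>\<^bsub>A\<^esub> a') b =
      tensor_ideal R \<alpha> A \<beta> B +>\<^bsub>P\<^esub> (frag_of (a, b) + frag_of (a', b))"
    unfolding pure_tensor_def using relator_intros(1)[OF assms] assms
    by (intro tensor_coset_eqI frag_of_closed) (simp_all add: diff_diff_eq)
  then show ?thesis
    using ring_hom_add[OF tensor_coset_hom, of "frag_of (a, b)" "frag_of (a', b)"] assms
    by (simp add: pure_tensor_def frag_of_closed pair_ring_simps(2))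
qed

lemma pure_scalar:
  assumes "r \<in> carrier R" "a \<in> carrier A" "b \<in> carrier B"
  shows "pure (\<alpha> r \<otimes>\<^bsub>A\<^esub> a) b = pure a (\<beta> r \<otimes>\<^bsub>B\<^esub> b)"
  unfolding pure_tensor_def using relator_intros(3)[OF assms] assms
  by (intro tensor_coset_eqI frag_of_closed) (simp_all add: \<alpha>_closed \<beta>_closed)

lemma pure_central:
  assumes a: "a \<in> carrier A" "\<And>a'. a' \<in> carrier A \<Longrightarrow> a \<otimes>\<^bsub>A\<^esub> a' = a' \<otimes>\<^bsub>A\<^esub> a"
    and "Y \<in> carrier T"
  shows "pure a \<one>\<^bsub>B\<^esub> \<otimes>\<^bsub>T\<^esub> Y = Y \<otimes>\<^bsub>T\<^esub> pure a \<one>\<^bsub>B\<^esub>"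
proof -
  obtain x where x: "x \<in> carrier P" "Y = tensor_ideal R \<alpha> A \<beta> B +>\<^bsub>P\<^esub> x"
    using assms(3) by (auto simp: tensor_carrier)
  let ?f = "frag_of (a, \<one>\<^bsub>B\<^esub>)"
  have f: "?f \<in> carrier P"
    using a(1) by (intro frag_of_closed) auto
  have "?f \<otimes>\<^bsub>P\<^esub> x = x \<otimes>\<^bsub>P\<^esub> ?f"
    using x(1) unfolding pair_ring_simps
  proof (induction x rule: frag_induction)
    case (one p)
    then show ?case by (cases p) (simp add: pair_ring_mult_of a(2))
  qed (simp_all add: pair_ring_mult_zero pair_ring_mult_diff)
  then show ?thesis
    unfolding pure_tensor_def x(2)
    by (simp only: ring_hom_mult[OF tensor_coset_hom f x(1), symmetric]
        ring_hom_mult[OF tensor_coset_hom x(1) f, symmetric])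
qed

end


section \<open>Cartan matrices of type ADE\<close>

datatype ade = A_type nat | D_type nat | E_type nat

fun ade_valid :: "ade \<Rightarrow> bool" where
  "ade_valid (A_type n) \<longleftrightarrow> n \<ge> 1"
| "ade_valid (D_type n) \<longleftrightarrow> n \<ge> 4"
| "ade_valid (E_type n) \<longleftrightarrow> n \<in> {6, 7, 8}"

fun ade_rank :: "ade \<Rightarrow> nat" where
  "ade_rank (A_type n) = n"
| "ade_rank (D_type n) = n"
| "ade_rank (E_type n) = n"

text \<open>Edges \<open>(a, b)\<close> with \<open>a < b\<close> of the Dynkin diagram, in Bourbaki's numbering of the vertices.\<close>

fun ade_edges :: "ade \<Rightarrow> (nat \<times> nat) set" where
  "ade_edges (A_type n) = {(a, a + 1) | a. 1 \<le> a \<and> a + 1 \<le> n}"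
| "ade_edges (D_type n) = {(a, a + 1) | a. 1 \<le> a \<and> a + 1 \<le> n - 1} \<union> {(n - 2, n)}"
| "ade_edges (E_type n) = {(1, 3), (2, 4)} \<union> {(a, a + 1) | a. 3 \<le> a \<and> a + 1 \<le> n}"

definition ade_cartan_entry :: "ade \<Rightarrow> nat \<Rightarrow> nat \<Rightarrow> int"
  where "ade_cartan_entry T a b =
    (if a = b then 2 else if (a, b) \<in> ade_edges T \<or> (b, a) \<in> ade_edges T then -1 else 0)"

text \<open>The index set \<open>\<I>\<^sub>0\<close> is the type \<^typ>\<open>'i\<close>, which is finite by this definition.\<close>

definition is_ade_cartan :: "('i \<Rightarrow> 'i \<Rightarrow> int) \<Rightarrow> bool"
  where "is_ade_cartan c \<longleftrightarrow>
    (\<exists>T e. ade_valid T \<and> bij_betw e (UNIV :: 'i set) {1..ade_rank T} \<and>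
      (\<forall>i j. c i j = ade_cartan_entry T (e i) (e j)))"


section \<open>The two presentations\<close>

type_synonym qv = "rat poly fract"

definition v :: qv where "v = to_fract [:0, 1:]"

definition vint :: "int \<Rightarrow> qv"
  where "vint n = (v powi n - v powi (- n)) / (v - inverse v)"

text \<open>
  Both algebras use the same letters. \<open>Z\<close> stands for \<open>C\<close> in the first presentation
  and for \<open>C\<^sup>1\<^sup>/\<^sup>2\<close> in the second one, and \<open>H\<close> stands for \<open>H\<close> and for \<open>H\<close>-hat respectively.
  The letter \<open>H_Suc i m\<close> is the generator of index \<open>(i, m + 1)\<close>, as these generators start at \<open>1\<close>.
\<close>

datatype 'i gen = K 'i | K_inv 'i | Z | Z_inv | H_Suc 'i nat | B 'i int

type_synonym 'i falg = "('i gen, qv) free_alg"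

definition xK :: "'i \<Rightarrow> 'i falg" where "xK i = letter (K i)"
definition xK_inv :: "'i \<Rightarrow> 'i falg" where "xK_inv i = letter (K_inv i)"
definition xH :: "'i \<Rightarrow> nat \<Rightarrow> 'i falg" where "xH i m = letter (H_Suc i (m - 1))"
definition xB :: "'i \<Rightarrow> int \<Rightarrow> 'i falg" where "xB i l = letter (B i l)"

definition xZ :: "int \<Rightarrow> 'i falg"
  where "xZ n = (if n \<ge> 0 then letter Z ^ nat n else letter Z_inv ^ nat (- n))"

definition comm :: "'i falg \<Rightarrow> 'i falg \<Rightarrow> 'i falg"
  where "comm x y = x * y - y * x"

text \<open>\<open>vcomm a x y\<close> is the twisted commutator \<open>[x, y]\<close> with subscript \<open>v\<^sup>a\<close>.\<close>

definition vcomm :: "int \<Rightarrow> 'i falg \<Rightarrow> 'i falg \<Rightarrow> 'i falg"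
  where "vcomm a x y = x * y - scalar (v powi a) * (y * x)"

text \<open>
  The exponential of a power series without constant term. Its coefficients are formed in the free
  algebra; the letters \<open>H\<close> commute only after passing to the quotient.
\<close>

definition exp_series :: "'i falg fps \<Rightarrow> 'i falg fps"
  where "exp_series f = Abs_fps (\<lambda>n. \<Sum>k\<le>n. scalar (1 / of_nat (fact k)) * fps_nth (f ^ k) n)"

definition H_series :: "'i \<Rightarrow> 'i falg fps"
  where "H_series i = Abs_fps (\<lambda>m. if m = 0 then 0 else scalar (v - inverse v) * xH i m)"

definition xTheta :: "'i \<Rightarrow> int \<Rightarrow> 'i falg"
  where "xTheta i r =
    (if r < 0 then 0
     else if r = 0 then scalar (1 / (v - inverse v))
     else scalar (1 / (v - inverse v)) * fps_nth (exp_series (H_series i)) (nat r))"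

definition serre :: "'i \<Rightarrow> 'i \<Rightarrow> int \<Rightarrow> int \<Rightarrow> int \<Rightarrow> 'i falg"
  where "serre i j k1 k2 l =
    xB i k1 * xB i k2 * xB j l - scalar (vint 2) * (xB i k1 * xB j l * xB i k2)
      + xB j l * xB i k1 * xB i k2"

text \<open>
  The sums over \<open>p\<close> are finite since \<^const>\<open>xTheta\<close> vanishes at negative indices;
  \<^const>\<open>Sum_any\<close> adds up the nonzero terms.
\<close>

definition Dr_rhs :: "'i \<Rightarrow> 'i \<Rightarrow> int \<Rightarrow> int \<Rightarrow> int \<Rightarrow> 'i falg"
  where "Dr_rhs i j k1 k2 l =
    xK i * xZ k1 *
    (- Sum_any (\<lambda>p::nat. scalar (v powi (2 * int p) * vint 2) *
          vcomm (-2) (xTheta i (k2 - k1 - 2 * int p - 1)) (xB j (l - 1)) * xZ (int p + 1))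
     - Sum_any (\<lambda>p::nat. (scalar (v powi (2 * int p - 1) * vint 2) *
          vcomm (-2) (xB j l) (xTheta i (k2 - k1 - 2 * int p)) * xZ (int p)) when p \<ge> 1)
     - vcomm (-2) (xB j l) (xTheta i (k2 - k1)))"

inductive Dr_rel :: "('i \<Rightarrow> 'i \<Rightarrow> int) \<Rightarrow> 'i falg \<Rightarrow> 'i falg \<Rightarrow> bool"
  for c :: "'i \<Rightarrow> 'i \<Rightarrow> int"
  where
  K_central: "Dr_rel c (xK i * x) (x * xK i)"
| C_central: "Dr_rel c (xZ 1 * x) (x * xZ 1)"
| HH: "m \<ge> 1 \<Longrightarrow> n \<ge> 1 \<Longrightarrow> Dr_rel c (comm (xH i m) (xH j n)) 0"
| K_inverse: "Dr_rel c (xK i * xK_inv i) 1"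
| C_inverse: "Dr_rel c (xZ 1 * xZ (-1)) 1"
| HB: "m \<ge> 1 \<Longrightarrow> Dr_rel c (comm (xH i m) (xB j l))
    (scalar (vint (int m * c i j) / of_nat m) * xB j (l + int m)
     - scalar (vint (int m * c i j) / of_nat m) * (xB j (l - int m) * xZ (int m)))"
| BB_zero: "c i j = 0 \<Longrightarrow> Dr_rel c (comm (xB i k) (xB j l)) 0"
| BB_distinct: "i \<noteq> j \<Longrightarrow> Dr_rel c
    (vcomm (- c i j) (xB i k) (xB j (l + 1))
     - scalar (v powi (- c i j)) * vcomm (c i j) (xB i (k + 1)) (xB j l)) 0"
| BB_same: "Dr_rel c
    (vcomm (-2) (xB i k) (xB i (l + 1)) - scalar (v powi (-2)) * vcomm 2 (xB i (k + 1)) (xB i l))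
    (scalar (v powi (-2)) * (xTheta i (l - k + 1) * xZ k * xK i)
     - scalar (v powi (-4)) * (xTheta i (l - k - 1) * xZ (k + 1) * xK i)
     + scalar (v powi (-2)) * (xTheta i (k - l + 1) * xZ l * xK i)
     - scalar (v powi (-4)) * (xTheta i (k - l - 1) * xZ (l + 1) * xK i))"
| Serre: "c i j = -1 \<Longrightarrow> Dr_rel c
    (serre i j k1 k2 l + serre i j k2 k1 l) (Dr_rhs i j k1 k2 l + Dr_rhs i j k2 k1 l)"

definition DR_rhs :: "'i \<Rightarrow> 'i \<Rightarrow> int \<Rightarrow> int \<Rightarrow> int \<Rightarrow> 'i falg"
  where "DR_rhs i j k1 k2 l =
    xK i * xZ (k1 + k2) *
    (- Sum_any (\<lambda>p::nat. scalar (v powi (2 * int p) * vint 2) *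
          vcomm (-2) (xTheta i (k2 - k1 - 2 * int p - 1)) (xB j (l - 1)) * xZ 1)
     - Sum_any (\<lambda>p::nat. scalar (v powi (2 * int p - 1) * vint 2) *
          vcomm (-2) (xB j l) (xTheta i (k2 - k1 - 2 * int p)))
     + scalar (v powi (-2)) * vcomm (-2) (xB j l) (xTheta i (k2 - k1)))"

inductive DR_rel :: "('i \<Rightarrow> 'i \<Rightarrow> int) \<Rightarrow> 'i falg \<Rightarrow> 'i falg \<Rightarrow> bool"
  for c :: "'i \<Rightarrow> 'i \<Rightarrow> int"
  where
  K_inverse: "DR_rel c (xK i * xK_inv i) 1"
| C_inverse: "DR_rel c (xZ 1 * xZ (-1)) 1"
| K_central: "DR_rel c (xK i * x) (x * xK i)"
| C_central: "DR_rel c (xZ 1 * x) (x * xZ 1)"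
| C_inv_central: "DR_rel c (xZ (-1) * x) (x * xZ (-1))"
| HH: "m \<ge> 1 \<Longrightarrow> n \<ge> 1 \<Longrightarrow> DR_rel c (comm (xH i m) (xH j n)) 0"
| HB: "m \<ge> 1 \<Longrightarrow> DR_rel c (comm (xH i m) (xB j l))
    (scalar (vint (int m * c i j) / of_nat m) * (xB j (l + int m) * xZ (- int m))
     - scalar (vint (int m * c i j) / of_nat m) * (xB j (l - int m) * xZ (int m)))"
| BB_zero: "c i j = 0 \<Longrightarrow> DR_rel c (comm (xB i k) (xB j l)) 0"
| BB_distinct: "i \<noteq> j \<Longrightarrow> DR_rel c
    (vcomm (- c i j) (xB i k) (xB j (l + 1))
     - scalar (v powi (- c i j)) * vcomm (c i j) (xB i (k + 1)) (xB j l)) 0"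
| BB_same: "DR_rel c
    (vcomm (-2) (xB i k) (xB i (l + 1)) - scalar (v powi (-2)) * vcomm 2 (xB i (k + 1)) (xB i l))
    (xK i * xZ (k + l + 1) *
      (scalar (v powi (-2)) * xTheta i (l - k + 1) - scalar (v powi (-4)) * xTheta i (l - k - 1)
       + scalar (v powi (-2)) * xTheta i (k - l + 1) - scalar (v powi (-4)) * xTheta i (k - l - 1)))"
| Serre: "c i j = -1 \<Longrightarrow> DR_rel c
    (serre i j k1 k2 l + serre i j k2 k1 l) (DR_rhs i j k1 k2 l + DR_rhs i j k2 k1 l)"

definition Dr_alg :: "('i \<Rightarrow> 'i \<Rightarrow> int) \<Rightarrow> (qv, 'i falg set) module"
  where "Dr_alg c = presented_algebra (Dr_rel c)"

definition DR_alg :: "('i \<Rightarrow> 'i \<Rightarrow> int) \<Rightarrow> (qv, 'i falg set) module"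
  where "DR_alg c = presented_algebra (DR_rel c)"


section \<open>Adjoining the square root of \<open>C\<close>\<close>

text \<open>
  Laurent polynomials in one variable over \<open>\<rat>(v)\<close>, used both in the variable \<open>C\<close> and in the
  variable \<open>C\<^sup>1\<^sup>/\<^sup>2\<close>. The inclusion of the former ring into the latter doubles the exponents.
\<close>

type_synonym laurent = "int \<Rightarrow>\<^sub>0 qv"

definition laurent_incl :: "laurent \<Rightarrow> laurent"
  where "laurent_incl f =
    (\<Sum>n\<in>Poly_Mapping.keys f. Poly_Mapping.single (2 * n) (Poly_Mapping.lookup f n))"

definition Dr_laurent :: "('i \<Rightarrow> 'i \<Rightarrow> int) \<Rightarrow> laurent \<Rightarrow> 'i falg set"
  where "Dr_laurent c f = coset (Dr_rel c)
    (\<Sum>n\<in>Poly_Mapping.keys f. scalar (Poly_Mapping.lookup f n) * xZ n)"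

text \<open>\<open>Dr_tensor c x n\<close> is the pure tensor of \<open>x\<close> and \<open>C\<^sup>n\<^sup>/\<^sup>2\<close>.\<close>

definition Dr_tensor :: "('i \<Rightarrow> 'i \<Rightarrow> int) \<Rightarrow> 'i falg set \<Rightarrow> int \<Rightarrow> ('i falg set \<times> laurent \<Rightarrow>\<^sub>0 int) set"
  where "Dr_tensor c x n =
    pure_tensor (ring_of_type_algebra :: laurent ring) (Dr_laurent c) (Dr_alg c)
      laurent_incl ring_of_type_algebra x (Poly_Mapping.single n 1)"

definition Dr_half_alg :: "('i \<Rightarrow> 'i \<Rightarrow> int) \<Rightarrow> (qv, ('i falg set \<times> laurent \<Rightarrow>\<^sub>0 int) set) module"
  where "Dr_half_alg c =
    algebra_via
      (tensor_ring (ring_of_type_algebra :: laurent ring) (Dr_laurent c) (Dr_alg c)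
        laurent_incl ring_of_type_algebra)
      (\<lambda>k. Dr_tensor c (coset (Dr_rel c) (scalar k)) 0)"

subsection \<open>These are indeed algebras\<close>

lemma assoc_algebra_Dr: "assoc_algebra (ring_of_type_algebra :: qv ring) (Dr_alg c)"
  unfolding Dr_alg_def by (rule assoc_algebra_presented)

lemma assoc_algebra_DR: "assoc_algebra (ring_of_type_algebra :: qv ring) (DR_alg c)"
  unfolding DR_alg_def by (rule assoc_algebra_presented)

lemma Dr_alg_simps:
  "carrier (Dr_alg c) = range (coset (Dr_rel c))"
  "coset (Dr_rel c) x \<otimes>\<^bsub>Dr_alg c\<^esub> coset (Dr_rel c) y = coset (Dr_rel c) (x * y)"
  "coset (Dr_rel c) x \<oplus>\<^bsub>Dr_alg c\<^esub> coset (Dr_rel c) y = coset (Dr_rel c) (x + y)"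
  "\<one>\<^bsub>Dr_alg c\<^esub> = coset (Dr_rel c) 1"
  by (simp_all add: Dr_alg_def presented_algebra_def algebra_via_def coset_surj coset_mult coset_add
      coset_one)

lemma coset_mult_cong:
  "coset rel x = coset rel x' \<Longrightarrow> coset rel y = coset rel y' \<Longrightarrow> coset rel (x * y) = coset rel (x' * y')"
  by (simp add: coset_mult)

lemma coset_sum_cong:
  assumes "\<And>s. s \<in> S \<Longrightarrow> coset rel (f s) = coset rel (g s)"
  shows "coset rel (\<Sum>s\<in>S. f s) = coset rel (\<Sum>s\<in>S. g s)"
  using assms by (induction S rule: infinite_finite_induct) (simp_all add: coset_add)

lemma Dr_Z_central:
  "coset (Dr_rel c) (letter Z * x) = coset (Dr_rel c) (x * letter Z)"
  using coset_eqI[of "Dr_rel c", OF Dr_rel.C_central[of c x]] by (simp add: xZ_def)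

lemma Dr_Z_inverse:
  "coset (Dr_rel c) (letter Z * letter Z_inv) = coset (Dr_rel c) 1"
  "coset (Dr_rel c) (letter Z_inv * letter Z) = coset (Dr_rel c) 1"
  using coset_eqI[of "Dr_rel c", OF Dr_rel.C_inverse[of c]] Dr_Z_central[of c "letter Z_inv"]
  by (simp_all add: xZ_def)

lemma Dr_Z_inv_central:
  "coset (Dr_rel c) (letter Z_inv * x) = coset (Dr_rel c) (x * letter Z_inv)"
proof -
  note cong = coset_mult_cong[of "Dr_rel c"]
  have "coset (Dr_rel c) (letter Z_inv * x) = coset (Dr_rel c) (letter Z_inv * x * (letter Z * letter Z_inv))"
    using cong[OF refl Dr_Z_inverse(1), of "letter Z_inv * x"] by simp
  also have "\<dots> = coset (Dr_rel c) (letter Z_inv * (x * letter Z) * letter Z_inv)"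
    by (simp add: mult.assoc)
  also have "\<dots> = coset (Dr_rel c) (letter Z_inv * (letter Z * x) * letter Z_inv)"
    by (intro cong refl Dr_Z_central[symmetric])
  also have "\<dots> = coset (Dr_rel c) (letter Z_inv * letter Z * (x * letter Z_inv))"
    by (simp add: mult.assoc)
  also have "\<dots> = coset (Dr_rel c) (x * letter Z_inv)"
    using cong[OF Dr_Z_inverse(2) refl, of "x * letter Z_inv"] by simp
  finally show ?thesis .
qed

lemma Dr_pow_central:
  assumes "\<And>x. coset (Dr_rel c) (z * x) = coset (Dr_rel c) (x * z)"
  shows "coset (Dr_rel c) (z ^ n * x) = coset (Dr_rel c) (x * z ^ n)"
proof (induction n)
  case (Suc n)
  note cong = coset_mult_cong[of "Dr_rel c"]
  have "coset (Dr_rel c) (z ^ Suc n * x) = coset (Dr_rel c) (z * (z ^ n * x))"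
    by (simp add: mult.assoc)
  also have "\<dots> = coset (Dr_rel c) (z * (x * z ^ n))"
    by (intro cong refl Suc.IH)
  also have "\<dots> = coset (Dr_rel c) ((z * x) * z ^ n)"
    by (simp add: mult.assoc)
  also have "\<dots> = coset (Dr_rel c) ((x * z) * z ^ n)"
    by (intro cong refl assms)
  finally show ?case
    by (simp add: mult.assoc)
qed simp

lemma Dr_xZ_central: "coset (Dr_rel c) (xZ n * x) = coset (Dr_rel c) (x * xZ n)"
  by (simp add: xZ_def Dr_pow_central Dr_Z_central Dr_Z_inv_central)

lemma Dr_xZ_Suc: "coset (Dr_rel c) (xZ (n + 1)) = coset (Dr_rel c) (letter Z * xZ n)"
proof (cases "n \<ge> 0")
  case True
  then show ?thesis by (simp add: xZ_def nat_add_distrib)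
next
  case False
  then have "xZ n = letter Z_inv * (xZ (n + 1) :: 'a falg)"
    by (cases "n = -1") (simp_all add: xZ_def Suc_nat_eq_nat_zadd1 flip: power_Suc)
  then show ?thesis
    using coset_mult_cong[OF Dr_Z_inverse(1) refl, of c "xZ (n + 1)"] by (simp add: mult.assoc)
qed

lemma Dr_xZ_pred: "coset (Dr_rel c) (xZ (n - 1)) = coset (Dr_rel c) (letter Z_inv * xZ n)"
proof -
  note cong = coset_mult_cong[of "Dr_rel c"]
  have "coset (Dr_rel c) (letter Z_inv * xZ n) = coset (Dr_rel c) (letter Z_inv * (letter Z * xZ (n - 1)))"
    using Dr_xZ_Suc[of c "n - 1"] by (intro cong refl) simp
  also have "\<dots> = coset (Dr_rel c) (letter Z_inv * letter Z * xZ (n - 1))"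
    by (simp add: mult.assoc)
  also have "\<dots> = coset (Dr_rel c) (xZ (n - 1))"
    using cong[OF Dr_Z_inverse(2) refl, of "xZ (n - 1)"] by simp
  finally show ?thesis by simp
qed

lemma Dr_xZ_add: "coset (Dr_rel c) (xZ (m + n)) = coset (Dr_rel c) (xZ m * xZ n)"
proof (induction m rule: int_induct[of _ 0])
  case base
  then show ?case by (simp add: xZ_def)
next
  case (step1 m)
  note cong = coset_mult_cong[of "Dr_rel c"]
  have "coset (Dr_rel c) (xZ (m + 1 + n)) = coset (Dr_rel c) (letter Z * xZ (m + n))"
    using Dr_xZ_Suc[of c "m + n"] by (simp add: add_ac)
  also have "\<dots> = coset (Dr_rel c) (letter Z * (xZ m * xZ n))"
    by (intro cong refl step1)
  also have "\<dots> = coset (Dr_rel c) (letter Z * xZ m * xZ n)"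
    by (simp add: mult.assoc)
  also have "\<dots> = coset (Dr_rel c) (xZ (m + 1) * xZ n)"
    by (intro cong refl Dr_xZ_Suc[symmetric])
  finally show ?case .
next
  case (step2 m)
  note cong = coset_mult_cong[of "Dr_rel c"]
  have "coset (Dr_rel c) (xZ (m - 1 + n)) = coset (Dr_rel c) (letter Z_inv * xZ (m + n))"
    using Dr_xZ_pred[of c "m + n"] by (simp add: algebra_simps)
  also have "\<dots> = coset (Dr_rel c) (letter Z_inv * (xZ m * xZ n))"
    by (intro cong refl step2)
  also have "\<dots> = coset (Dr_rel c) (letter Z_inv * xZ m * xZ n)"
    by (simp add: mult.assoc)
  also have "\<dots> = coset (Dr_rel c) (xZ (m - 1) * xZ n)"
    by (intro cong refl Dr_xZ_pred[symmetric])
  finally show ?case .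
qed

definition laurent_sum :: "(int \<Rightarrow> qv \<Rightarrow> 'a::comm_monoid_add) \<Rightarrow> laurent \<Rightarrow> 'a"
  where "laurent_sum t f = (\<Sum>n\<in>Poly_Mapping.keys f. t n (Poly_Mapping.lookup f n))"

lemma laurent_sum_single:
  "(\<And>n. t n 0 = 0) \<Longrightarrow> laurent_sum t (Poly_Mapping.single n a) = t n a"
  by (cases "a = 0") (simp_all add: laurent_sum_def)

lemma laurent_sum_add:
  assumes zero: "\<And>n. t n 0 = 0" and add: "\<And>n a b. t n (a + b) = t n a + t n b"
  shows "laurent_sum t (f + g) = laurent_sum t f + laurent_sum t g"
proof -
  let ?S = "Poly_Mapping.keys f \<union> Poly_Mapping.keys g"
  have *: "laurent_sum t h = (\<Sum>n\<in>?S. t n (Poly_Mapping.lookup h n))"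
    if "Poly_Mapping.keys h \<subseteq> ?S" for h
    unfolding laurent_sum_def using that
    by (intro sum.mono_neutral_left) (auto simp: in_keys_iff zero)
  show ?thesis
    using *[of "f + g"] *[of f] *[of g] Poly_Mapping.keys_add[of f g]
    by (simp add: lookup_add add sum.distrib)
qed

lemma laurent_sum_sum:
  assumes "\<And>n. t n 0 = 0" "\<And>n a b. t n (a + b) = t n a + t n b"
  shows "laurent_sum t (\<Sum>s\<in>S. F s) = (\<Sum>s\<in>S. laurent_sum t (F s))"
  by (induction S rule: infinite_finite_induct)
    (simp_all add: laurent_sum_add assms, simp_all add: laurent_sum_def)

lemma laurent_sum_mult:
  assumes "\<And>n. t n 0 = 0" "\<And>n a b. t n (a + b) = t n a + t n b"
  shows "laurent_sum t (f * g) =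
    (\<Sum>m\<in>Poly_Mapping.keys f. \<Sum>n\<in>Poly_Mapping.keys g.
      t (m + n) (Poly_Mapping.lookup f m * Poly_Mapping.lookup g n))"
proof -
  have "f * g = (\<Sum>m\<in>Poly_Mapping.keys f. \<Sum>n\<in>Poly_Mapping.keys g.
      Poly_Mapping.single (m + n) (Poly_Mapping.lookup f m * Poly_Mapping.lookup g n))"
    using sum_monomials[of f] sum_monomials[of g]
    by (simp only: mult_single[symmetric] sum_product[symmetric])
  then have "laurent_sum t (f * g) = laurent_sum t (\<Sum>m\<in>Poly_Mapping.keys f. \<Sum>n\<in>Poly_Mapping.keys g.
      Poly_Mapping.single (m + n) (Poly_Mapping.lookup f m * Poly_Mapping.lookup g n))"
    by (rule arg_cong)
  then show ?thesis
    by (simp only: laurent_sum_sum[of t, OF assms] laurent_sum_single[of t, OF assms(1)])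
qed

lemma laurent_incl_hom: "laurent_incl \<in> ring_hom ring_of_type_algebra ring_of_type_algebra"
proof -
  let ?t = "\<lambda>n a. Poly_Mapping.single (2 * n :: int) (a :: qv)"
  have eq: "laurent_incl = laurent_sum ?t"
    by (simp add: laurent_incl_def laurent_sum_def fun_eq_iff)
  have t: "?t n 0 = 0" "?t n (a + b) = ?t n a + ?t n b" for n a b
    by (simp_all add: single_add)
  have mult: "laurent_sum ?t (f * g) = laurent_sum ?t f * laurent_sum ?t g" for f g
    by (simp only: laurent_sum_mult[of ?t, OF t])
      (simp add: laurent_sum_def sum_product mult_single distrib_left)
  have "laurent_sum ?t (Poly_Mapping.single 0 1) = 1"
    by (simp only: laurent_sum_single[of ?t, OF t(1)]) simp
  then show ?thesis
    unfolding eq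
    by (intro ring_hom_memI) (simp_all add: mult laurent_sum_add[of ?t, OF t])
qed

lemma Dr_laurent_hom:
  fixes c :: "'i \<Rightarrow> 'i \<Rightarrow> int"
  shows "Dr_laurent c \<in> ring_hom ring_of_type_algebra (Dr_alg c)"
proof -
  let ?t = "\<lambda>n a. scalar a * xZ n :: 'i falg"
  have eq: "Dr_laurent c = (\<lambda>f. coset (Dr_rel c) (laurent_sum ?t f))"
    by (simp add: Dr_laurent_def laurent_sum_def fun_eq_iff)
  have t: "?t n 0 = 0" "?t n (a + b) = ?t n a + ?t n b" for n a b
    by (simp_all add: scalar_add distrib_right) (simp add: scalar_def)
  have *: "coset (Dr_rel c) (?t (m + n) (a * b)) = coset (Dr_rel c) (?t m a * ?t n b)" for m n a b
  proof -
    have "coset (Dr_rel c) (?t (m + n) (a * b)) = coset (Dr_rel c) (scalar (a * b) * (xZ m * xZ n))"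
      by (intro coset_mult_cong refl Dr_xZ_add)
    also have "scalar (a * b) * (xZ m * xZ n) = scalar a * (scalar b * xZ m) * xZ n"
      by (simp add: scalar_mult_scalar mult.assoc)
    also have "\<dots> = ?t m a * ?t n b"
      by (simp only: scalar_central[of b "xZ m"] mult.assoc)
    finally show ?thesis .
  qed
  have mult: "coset (Dr_rel c) (laurent_sum ?t (f * g)) =
      coset (Dr_rel c) (laurent_sum ?t f * laurent_sum ?t g)" for f g
  proof -
    have prod: "laurent_sum ?t f * laurent_sum ?t g =
        (\<Sum>m\<in>Poly_Mapping.keys f. \<Sum>n\<in>Poly_Mapping.keys g.
          ?t m (Poly_Mapping.lookup f m) * ?t n (Poly_Mapping.lookup g n))"
      by (simp only: laurent_sum_def sum_product)
    show ?thesis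
      by (simp only: laurent_sum_mult[of ?t, OF t] prod) (intro coset_sum_cong *)
  qed
  have "laurent_sum ?t (Poly_Mapping.single 0 1) = 1"
    by (simp only: laurent_sum_single[of ?t, OF t(1)]) (simp add: scalar_one xZ_def)
  then show ?thesis
    unfolding eq
    by (intro ring_hom_memI) (simp_all add: Dr_alg_simps mult laurent_sum_add[of ?t, OF t])
qed

lemma Dr_laurent_central:
  "coset (Dr_rel c) x \<otimes>\<^bsub>Dr_alg c\<^esub> Dr_laurent c f = Dr_laurent c f \<otimes>\<^bsub>Dr_alg c\<^esub> coset (Dr_rel c) x"
proof -
  have *: "coset (Dr_rel c) (x * (scalar a * xZ n)) = coset (Dr_rel c) (scalar a * xZ n * x)" for a n
  proof -
    have "x * (scalar a * xZ n) = scalar a * (x * xZ n)"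
      by (simp only: mult.assoc[symmetric] scalar_central[of a x])
    also have "coset (Dr_rel c) (scalar a * (x * xZ n)) = coset (Dr_rel c) (scalar a * (xZ n * x))"
      by (intro coset_mult_cong refl Dr_xZ_central[symmetric])
    finally show ?thesis by (simp add: mult.assoc)
  qed
  show ?thesis
    by (simp only: Dr_laurent_def Dr_alg_simps sum_distrib_left sum_distrib_right)
      (intro coset_sum_cong *)
qed

lemma tensor_factors_Dr:
  "tensor_factors ring_of_type_algebra (Dr_laurent c) (Dr_alg c) laurent_incl
    (ring_of_type_algebra :: laurent ring)"
proof -
  interpret D: assoc_algebra "ring_of_type_algebra :: qv ring" "Dr_alg c"
    by (rule assoc_algebra_Dr)
  show ?thesis
    using ring_hom_closed[OF Dr_laurent_hom] D.ring_axioms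
    by (intro tensor_factors.intro tensor_factors_axioms.intro ring_type_algebra)
      (auto simp: Dr_alg_simps(1) Dr_laurent_central mult.commute)
qed

lemma assoc_algebra_Dr_half: "assoc_algebra (ring_of_type_algebra :: qv ring) (Dr_half_alg c)"
proof -
  interpret tensor_factors "ring_of_type_algebra :: laurent ring" "Dr_laurent c" "Dr_alg c"
    laurent_incl "ring_of_type_algebra :: laurent ring"
    by (rule tensor_factors_Dr)
  have eq: "Dr_tensor c x 0 = pure x 1" for x
    by (simp add: Dr_tensor_def)
  show ?thesis
    unfolding Dr_half_alg_def eq
  proof (rule assoc_algebra_via)
    show "(\<lambda>k. pure (coset (Dr_rel c) (scalar k)) 1) \<in> ring_hom ring_of_type_algebra T"
    proof (rule ring_hom_memI)
      fix k l :: qv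
      show "pure (coset (Dr_rel c) (scalar k)) 1 \<in> carrier T"
        by (rule pure_closed) (simp_all add: Dr_alg_simps)
      show "pure (coset (Dr_rel c) (scalar (k \<otimes>\<^bsub>ring_of_type_algebra\<^esub> l))) 1 =
          pure (coset (Dr_rel c) (scalar k)) 1 \<otimes>\<^bsub>T\<^esub> pure (coset (Dr_rel c) (scalar l)) 1"
        by (subst pure_mult) (simp_all add: Dr_alg_simps scalar_mult_scalar)
      show "pure (coset (Dr_rel c) (scalar (k \<oplus>\<^bsub>ring_of_type_algebra\<^esub> l))) 1 =
          pure (coset (Dr_rel c) (scalar k)) 1 \<oplus>\<^bsub>T\<^esub> pure (coset (Dr_rel c) (scalar l)) 1"
        by (subst pure_add_left[symmetric]) (simp_all add: Dr_alg_simps scalar_add)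
    next
      show "pure (coset (Dr_rel c) (scalar \<one>\<^bsub>ring_of_type_algebra\<^esub>)) 1 = \<one>\<^bsub>T\<^esub>"
        using pure_one by (simp add: Dr_alg_simps scalar_one)
    qed
  next
    fix k Y
    assume "Y \<in> carrier T"
    then show "pure (coset (Dr_rel c) (scalar k)) 1 \<otimes>\<^bsub>T\<^esub> Y =
        Y \<otimes>\<^bsub>T\<^esub> pure (coset (Dr_rel c) (scalar k)) 1"
      by (intro pure_central[unfolded ring_of_type_algebra_simps])
        (auto simp: Dr_alg_simps scalar_central)
  qed (auto intro: ring_tensor_ring comm_ring_1_class.cring_from_type_algebra)
qed

end

theory Submission
  imports Defs
    "HOL-Algebra.Free_Abelian_Groups"
begin

text \<open>
  Write \<open>D\<close> for the square root \<open>C\<^sup>1\<^sup>/\<^sup>2\<close>. Both algebras are given by generators and relations (with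
  a base change in one case), so homomorphisms out of them are determined by, and may be prescribed
  on, generators. The relations of the second presentation arise from those of the first
  by the substitution \<open>H\<^sub>m \<mapsto> H\<^sub>m D\<^sup>m\<close>, \<open>C \<mapsto> D\<^sup>2\<close>. Since \<open>D\<close> is central and invertible, this
  substitution can be undone, and it yields homomorphisms in both directions which are inverse to
  each other.

  The verification of the relations is the same bookkeeping in both directions and is done once, in
  the locale \<open>rescaling\<close>. Give \<open>H\<^sub>m\<close> the degree \<open>m\<close> and \<open>K\<close>, \<open>B\<close> the degree \<open>0\<close>. A homomorphism
  that multiplies each of these generators by \<open>D\<close> to the power \<open>\<plusminus>\<close> its degree does so for every
  homogeneous expression. As the exponential series is homogeneous, \<open>\<Theta>\<^sub>r\<close> has degree
  \<open>r\<close> (lemma \<open>h_Theta\<close>), and this is the whole content of the identification of the \<open>\<Theta>\<close>. Every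
  term of a relation is homogeneous once the powers of \<open>C\<close> are taken into account, and each relation
  of one presentation is sent to a relation of the other, up to a common power of \<open>D\<close>. The
  right-hand side of the Serre relation needs one preparation: the second presentation includes
  \<open>p = 0\<close> in its second sum and corrects for it, which gives the same element because
  \<open>v\<^sup>-\<^sup>1 [2] = 1 + v\<^sup>-\<^sup>2\<close> (lemma \<open>DR_rhs_eq\<close>).

  For the homomorphism out of the tensor product it remains to see that the map on
  the first factor and the evaluation of Laurent polynomials at \<open>D\<close> agree on \<open>\<rat>(v)[C, C\<^sup>-\<^sup>1]\<close>
  and have commuting images. The two composites are the identity as they fix generators.
\<close>

section \<open>Universal properties\<close>

lemma quotient_hom_exists:
  assumes "ideal I R" "ring S" "h \<in> ring_hom R S" "\<And>x. x \<in> I \<Longrightarrow> h x = \<zero>\<^bsub>S\<^esub>"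
  obtains H where "H \<in> ring_hom (R Quot I) S" "\<And>x. x \<in> carrier R \<Longrightarrow> H (I +>\<^bsub>R\<^esub> x) = h x"
proof -
  interpret I: ideal I R by fact
  interpret S: ring S by fact
  define H where "H U = the_elem (h ` U)" for U
  have H: "H (I +>\<^bsub>R\<^esub> x) = h x" if x: "x \<in> carrier R" for x
  proof -
    have "h y = h x" if "y \<in> I +>\<^bsub>R\<^esub> x" for y
      using that x I.Icarr ring_hom_add[OF assms(3)] ring_hom_closed[OF assms(3) x] assms(4)
      by (auto simp: a_r_coset_def')
    moreover have "x \<in> I +>\<^bsub>R\<^esub> x"
      using x by (rule I.a_rcos_self)
    ultimately have "h ` (I +>\<^bsub>R\<^esub> x) = {h x}"
      by blast
    then show ?thesis by (simp add: H_def)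
  qed
  have "H \<in> ring_hom (R Quot I) S"
  proof (rule ring_hom_memI)
    have carrier: "U \<in> carrier (R Quot I) \<Longrightarrow> \<exists>x\<in>carrier R. U = I +>\<^bsub>R\<^esub> x" for U
      by (auto simp: FactRing_def A_RCOSETS_def')
    note q = I.rcos_ring_hom
    fix U V
    assume "U \<in> carrier (R Quot I)"
    then obtain x where x: "x \<in> carrier R" "U = I +>\<^bsub>R\<^esub> x"
      using carrier by blast
    then show "H U \<in> carrier S"
      using ring_hom_closed[OF assms(3)] by (simp add: H)
    assume "V \<in> carrier (R Quot I)"
    then obtain y where y: "y \<in> carrier R" "V = I +>\<^bsub>R\<^esub> y"
      using carrier by blast
    show "H (U \<otimes>\<^bsub>R Quot I\<^esub> V) = H U \<otimes>\<^bsub>S\<^esub> H V" "H (U \<oplus>\<^bsub>R Quot I\<^esub> V) = H U \<oplus>\<^bsub>S\<^esub> H V"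
      using x y ring_hom_mult[OF q x(1) y(1)] ring_hom_add[OF q x(1) y(1)]
        ring_hom_mult[OF assms(3) x(1) y(1)] ring_hom_add[OF assms(3) x(1) y(1)]
      by (simp_all add: H flip: ring_hom_mult[OF q x(1) y(1)] ring_hom_add[OF q x(1) y(1)])
  next
    show "H \<one>\<^bsub>R Quot I\<^esub> = \<one>\<^bsub>S\<^esub>"
      using ring_hom_one[OF I.rcos_ring_hom] ring_hom_one[OF assms(3)] H[OF I.one_closed] by simp
  qed
  with H show ?thesis by (rule that[rotated])
qed

lemma poly_mapping_monomial_induct:
  fixes x :: "'m \<Rightarrow>\<^sub>0 'k::comm_monoid_add"
  assumes "\<And>w a. P (Poly_Mapping.single w a)" "\<And>x y. P x \<Longrightarrow> P y \<Longrightarrow> P (x + y)"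
  shows "P x"
proof -
  have "P 0" using assms(1)[of undefined 0] by simp
  have "P (\<Sum>w\<in>S. Poly_Mapping.single w (Poly_Mapping.lookup x w))" for S
    by (induction S rule: infinite_finite_induct) (simp_all add: \<open>P 0\<close> assms)
  from this[of "Poly_Mapping.keys x"] show ?thesis
    by (simp add: sum_monomials)
qed

text \<open>
  The universal property of monoid algebras: a homomorphism from a monoid into the multiplicative
  monoid of an algebra extends to the monoid algebra. It is applied to the free monoid, and
  to the integers, whose monoid algebra is the ring of Laurent polynomials.
\<close>

locale monoid_algebra_rep = assoc_algebra "ring_of_type_algebra :: 'k::field ring" A
  for A :: "('k::field, 'a, 'n) module_scheme" (structure) +
  fixes \<mu> :: "'m::monoid_add \<Rightarrow> 'a"
  assumes \<mu>_closed [simp]: "\<mu> w \<in> carrier A"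
    and \<mu>_zero: "\<mu> 0 = \<one>\<^bsub>A\<^esub>"
    and \<mu>_add: "\<mu> (w + w') = \<mu> w \<otimes>\<^bsub>A\<^esub> \<mu> w'"
begin

definition extend :: "('m \<Rightarrow>\<^sub>0 'k) \<Rightarrow> 'a"
  where "extend x = (\<Oplus>\<^bsub>A\<^esub>w\<in>Poly_Mapping.keys x. Poly_Mapping.lookup x w \<odot>\<^bsub>A\<^esub> \<mu> w)"

lemma term_closed [simp]: "k \<odot>\<^bsub>A\<^esub> \<mu> w \<in> carrier A"
  by (intro smult_closed) simp_all

lemma extend_closed: "extend x \<in> carrier A"
  unfolding extend_def by (intro M.finsum_closed) simp

lemma zero_smult: "a \<in> carrier A \<Longrightarrow> 0 \<odot>\<^bsub>A\<^esub> a = \<zero>\<^bsub>A\<^esub>"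
  using smult_l_null[of a] by simp

lemma extend_superset:
  assumes "finite S" "Poly_Mapping.keys x \<subseteq> S"
  shows "extend x = (\<Oplus>\<^bsub>A\<^esub>w\<in>S. Poly_Mapping.lookup x w \<odot>\<^bsub>A\<^esub> \<mu> w)"
  unfolding extend_def using assms
  by (intro M.add.finprod_mono_neutral_cong_left) (auto simp: in_keys_iff zero_smult)

lemma extend_add: "extend (x + y) = extend x \<oplus>\<^bsub>A\<^esub> extend y"
proof -
  let ?S = "Poly_Mapping.keys x \<union> Poly_Mapping.keys y"
  have "extend (x + y) = (\<Oplus>\<^bsub>A\<^esub>w\<in>?S. Poly_Mapping.lookup x w \<odot>\<^bsub>A\<^esub> \<mu> w
      \<oplus>\<^bsub>A\<^esub> Poly_Mapping.lookup y w \<odot>\<^bsub>A\<^esub> \<mu> w)"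
    unfolding extend_superset[of ?S, OF _ Poly_Mapping.keys_add, simplified]
    by (intro M.finsum_cong') (use smult_l_distr in \<open>auto simp: lookup_add\<close>)
  then show ?thesis
    by (simp add: extend_superset[of ?S x] extend_superset[of ?S y])
qed

lemma extend_single: "extend (Poly_Mapping.single w k) = k \<odot>\<^bsub>A\<^esub> \<mu> w"
  by (cases "k = 0") (simp_all add: extend_def zero_smult)

lemma extend_mult: "extend (x * y) = extend x \<otimes>\<^bsub>A\<^esub> extend y"
proof (induction x rule: poly_mapping_monomial_induct)
  case (1 w k)
  show ?case
  proof (induction y rule: poly_mapping_monomial_induct)
    case (1 w' k')
    have "(k * k') \<odot>\<^bsub>A\<^esub> (\<mu> w \<otimes>\<^bsub>A\<^esub> \<mu> w') = k \<odot>\<^bsub>A\<^esub> \<mu> w \<otimes>\<^bsub>A\<^esub> (k' \<odot>\<^bsub>A\<^esub> \<mu> w')"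
      using smult_assoc1[of k k' "\<mu> w \<otimes>\<^bsub>A\<^esub> \<mu> w'"] smult_mult_left[of k "\<mu> w" "k' \<odot>\<^bsub>A\<^esub> \<mu> w'"]
        smult_mult_right[of k' "\<mu> w" "\<mu> w'"]
      by simp
    then show ?case
      by (simp add: mult_single extend_single \<mu>_add)
  qed (simp add: distrib_left extend_add extend_closed A.r_distr)
qed (simp add: distrib_right extend_add extend_closed A.l_distr)

lemma extend_hom: "extend \<in> ring_hom ring_of_type_algebra A"
proof (rule ring_hom_memI)
  have "extend 1 = \<one>\<^bsub>A\<^esub>"
    unfolding single_one[symmetric] extend_single
    using smult_one[of "\<mu> 0"] by (simp add: \<mu>_zero)
  then show "extend \<one>\<^bsub>ring_of_type_algebra\<^esub> = \<one>\<^bsub>A\<^esub>"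
    by simp
qed (simp_all add: extend_closed extend_add extend_mult)

end

lemma free_alg_hom_exists:
  fixes A :: "('k::field, 'a, 'n) module_scheme"
  assumes "assoc_algebra ring_of_type_algebra A" "\<And>g. f g \<in> carrier A"
  obtains h where "h \<in> ring_hom ring_of_type_algebra A" "\<And>g. h (letter g) = f g"
    "\<And>k. h (scalar k) = k \<odot>\<^bsub>A\<^esub> \<one>\<^bsub>A\<^esub>"
proof -
  interpret A: assoc_algebra "ring_of_type_algebra :: 'k ring" A by fact
  define \<mu> where "\<mu> w = foldr (\<lambda>g x. f g \<otimes>\<^bsub>A\<^esub> x) (letters w) \<one>\<^bsub>A\<^esub>" for w
  have closed: "\<mu> w \<in> carrier A" for w
  proof (cases w)
    case (FMon gs)
    then show ?thesis
      by (induction gs arbitrary: w) (simp_all add: \<mu>_def assms(2))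
  qed
  have "\<mu> (FMon (gs @ hs)) = \<mu> (FMon gs) \<otimes>\<^bsub>A\<^esub> \<mu> (FMon hs)" for gs hs
  proof (induction gs)
    case Nil
    show ?case using closed[of "FMon hs"] by (simp add: \<mu>_def)
  next
    case (Cons g gs)
    have "\<mu> (FMon (g # as)) = f g \<otimes>\<^bsub>A\<^esub> \<mu> (FMon as)" for as
      by (simp add: \<mu>_def)
    with Cons.IH show ?case
      using closed assms(2) by (simp add: A.m_assoc)
  qed
  then have add: "\<mu> (w + w') = \<mu> w \<otimes>\<^bsub>A\<^esub> \<mu> w'" for w w'
    by (cases w; cases w') (simp add: plus_fmon_def)
  interpret monoid_algebra_rep A \<mu>
    by unfold_locales (simp_all add: closed add, simp add: \<mu>_def zero_fmon_def)
  show ?thesis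
  proof (rule that[OF extend_hom])
    show "extend (letter g) = f g" for g
      using A.smult_one[of "f g"] by (simp add: letter_def extend_single \<mu>_def assms(2))
    show "extend (scalar k) = k \<odot>\<^bsub>A\<^esub> \<one>\<^bsub>A\<^esub>" for k
      by (simp add: scalar_def extend_single \<mu>_zero)
  qed
qed

lemma free_alg_induct [case_names letter scalar add mult]:
  fixes x :: "('g, 'k::field) free_alg"
  assumes letter: "\<And>g. P (letter g)" and scalar: "\<And>k. P (scalar k)"
    and add: "\<And>x y. P x \<Longrightarrow> P y \<Longrightarrow> P (x + y)" and mult: "\<And>x y. P x \<Longrightarrow> P y \<Longrightarrow> P (x * y)"
  shows "P x"
proof (induction x rule: poly_mapping_monomial_induct)
  case (1 w a)
  have "P (Poly_Mapping.single (FMon gs) a)" for gs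
  proof (induction gs)
    case Nil
    then show ?case using scalar[of a] by (simp add: scalar_def zero_fmon_def)
  next
    case (Cons g gs)
    have "Poly_Mapping.single (FMon (g # gs)) a = letter g * Poly_Mapping.single (FMon gs) a"
      by (simp add: letter_def mult_single plus_fmon_def)
    then show ?case using mult[OF letter Cons.IH] by simp
  qed
  then show ?case by (cases w) simp
qed (rule add)

lemma presented_algebra_simps:
  "carrier (presented_algebra rel) = range (coset rel)"
  "coset rel x \<otimes>\<^bsub>presented_algebra rel\<^esub> coset rel y = coset rel (x * y)"
  "coset rel x \<oplus>\<^bsub>presented_algebra rel\<^esub> coset rel y = coset rel (x + y)"
  "\<one>\<^bsub>presented_algebra rel\<^esub> = coset rel 1"
  "k \<odot>\<^bsub>presented_algebra rel\<^esub> coset rel x = coset rel (scalar k * x)"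
  by (simp_all add: presented_algebra_def algebra_via_def coset_surj coset_mult coset_add coset_one)

lemma presented_algebra_hom_exists:
  assumes "ring A" "h \<in> ring_hom ring_of_type_algebra A" "\<And>x y. rel x y \<Longrightarrow> h x = h y"
  obtains H where "H \<in> ring_hom (presented_algebra rel) A" "\<And>x. H (coset rel x) = h x"
proof -
  interpret A: ring A by fact
  interpret h: ring_hom_ring ring_of_type_algebra A h
    by (intro ring_hom_ringI2 ring_type_algebra assms(1,2))
  have kernel: "h (x - y) = \<zero>\<^bsub>A\<^esub>" if "rel x y" for x y
  proof -
    have "h (x - y) \<oplus>\<^bsub>A\<^esub> h y = h x"
      using h.hom_add[of "x - y" y] by simp
    then show ?thesis
      using assms(3)[OF that] h.hom_closed[of "x - y"] h.hom_closed[of y] by simp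
  qed
  have "{x - y | x y. rel x y} \<subseteq> a_kernel ring_of_type_algebra A h"
    unfolding a_kernel_def' using kernel by fastforce
  then have "rel_ideal rel \<subseteq> a_kernel ring_of_type_algebra A h"
    unfolding rel_ideal_def
    by (rule ring.genideal_minimal[OF ring_type_algebra h.kernel_is_ideal])
  then have "h x = \<zero>\<^bsub>A\<^esub>" if "x \<in> rel_ideal rel" for x
    using that unfolding a_kernel_def' by blast
  from quotient_hom_exists[OF ideal_rel_ideal assms(1,2) this]
  obtain H where H: "H \<in> ring_hom (ring_of_type_algebra Quot rel_ideal rel) A"
    "\<And>x. x \<in> carrier ring_of_type_algebra \<Longrightarrow> H (rel_ideal rel +>\<^bsub>ring_of_type_algebra\<^esub> x) = h x"
    by blast
  show ?thesis
  proof (rule that)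
    show "H \<in> ring_hom (presented_algebra rel) A"
      using H(1) by (simp add: ring_hom_def presented_algebra_def algebra_via_def)
    show "H (coset rel x) = h x" for x
      using H(2)[of x] by (simp add: coset_def)
  qed
qed

context tensor_factors
begin

text \<open>
  The additive group of \<open>P\<close> is free on the pairs, so a biadditive map extends to \<open>P\<close>. Commuting
  images make the extension multiplicative, and the three kinds of relators go to zero because of
  additivity in either argument and of the agreement on \<open>R\<close>.
\<close>

lemma tensor_hom_exists:
  assumes "ring D" and f: "f \<in> ring_hom A D" and g: "g \<in> ring_hom B D"
    and comm: "\<And>a b. a \<in> carrier A \<Longrightarrow> b \<in> carrier B \<Longrightarrow> f a \<otimes>\<^bsub>D\<^esub> g b = g b \<otimes>\<^bsub>D\<^esub> f a"
    and agree: "\<And>r. r \<in> carrier R \<Longrightarrow> f (\<alpha> r) = g (\<beta> r)"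
  obtains h where "h \<in> ring_hom T D"
    "\<And>a b. a \<in> carrier A \<Longrightarrow> b \<in> carrier B \<Longrightarrow> h (pure a b) = f a \<otimes>\<^bsub>D\<^esub> g b"
proof -
  interpret D: ring D by fact
  interpret P: ring P by (rule ring_P)
  note f_simps = ring_hom_closed[OF f] ring_hom_add[OF f] ring_hom_mult[OF f] ring_hom_one[OF f]
  note g_simps = ring_hom_closed[OF g] ring_hom_add[OF g] ring_hom_mult[OF g] ring_hom_one[OF g]
  let ?S = "carrier A \<times> carrier B"
  obtain h where h: "h \<in> hom (free_Abelian_group ?S) (add_monoid D)"
    and h_of: "\<And>p. p \<in> ?S \<Longrightarrow> h (frag_of p) = f (fst p) \<otimes>\<^bsub>D\<^esub> g (snd p)"
    by (rule comm_group.free_Abelian_group_universal[of "add_monoid D"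
          "\<lambda>p. f (fst p) \<otimes>\<^bsub>D\<^esub> g (snd p)" ?S])
      (auto simp: f_simps g_simps D.a_comm_group)
  have h_closed: "h x \<in> carrier D" if "x \<in> carrier P" for x
    using hom_in_carrier[OF h, of x] that by (simp add: pair_ring_simps free_Abelian_group_def)
  have h_add: "h (x + y) = h x \<oplus>\<^bsub>D\<^esub> h y" if "x \<in> carrier P" "y \<in> carrier P" for x y
    using hom_mult[OF h, of x y] that by (simp add: pair_ring_simps free_Abelian_group_def)
  have P_diff: "x - y \<in> carrier P" if "x \<in> carrier P" "y \<in> carrier P" for x y
    using that keys_diff[of x y] unfolding pair_ring_simps by blast
  have h_diff: "h (x - y) = h x \<ominus>\<^bsub>D\<^esub> h y" if "x \<in> carrier P" "y \<in> carrier P" for x y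
  proof -
    have "h (x - y) \<oplus>\<^bsub>D\<^esub> h y = h x"
      using h_add[of "x - y" y] P_diff that by simp
    then show ?thesis
      using h_closed[OF P_diff[OF that]] h_closed that
      by (metis D.add.inv_solve_right' D.minus_eq)
  qed
  have P_zero: "0 \<in> carrier P"
    by (simp add: pair_ring_simps)
  have h_zero: "h 0 = \<zero>\<^bsub>D\<^esub>"
    using h_diff[OF P_zero P_zero] h_closed[OF P_zero] by (simp add: D.r_neg D.minus_eq)
  have h_pair: "h (frag_of (a, b)) = f a \<otimes>\<^bsub>D\<^esub> g b" if "a \<in> carrier A" "b \<in> carrier B" for a b
    using h_of[of "(a, b)"] that by simp
  have mult_pair: "h (frag_of (a, b) \<otimes>\<^bsub>P\<^esub> frag_of (a', b')) =
      h (frag_of (a, b)) \<otimes>\<^bsub>D\<^esub> h (frag_of (a', b'))"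
    if "a \<in> carrier A" "b \<in> carrier B" "a' \<in> carrier A" "b' \<in> carrier B" for a b a' b'
  proof -
    have "f a \<otimes>\<^bsub>D\<^esub> f a' \<otimes>\<^bsub>D\<^esub> (g b \<otimes>\<^bsub>D\<^esub> g b') = f a \<otimes>\<^bsub>D\<^esub> (f a' \<otimes>\<^bsub>D\<^esub> g b) \<otimes>\<^bsub>D\<^esub> g b'"
      using that by (simp add: D.m_assoc f_simps g_simps)
    also have "\<dots> = f a \<otimes>\<^bsub>D\<^esub> g b \<otimes>\<^bsub>D\<^esub> (f a' \<otimes>\<^bsub>D\<^esub> g b')"
      unfolding comm[OF that(3,2)] using that by (simp add: D.m_assoc f_simps g_simps)
    finally show ?thesis
      using that by (simp add: pair_ring_mult_of h_pair f_simps g_simps)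
  qed
  have mult: "h (x \<otimes>\<^bsub>P\<^esub> y) = h x \<otimes>\<^bsub>D\<^esub> h y" if "x \<in> carrier P" "y \<in> carrier P" for x y
  proof -
    have "x \<in> carrier P \<and> h (x \<otimes>\<^bsub>P\<^esub> y) = h x \<otimes>\<^bsub>D\<^esub> h y"
      using that(1)[unfolded pair_ring_simps]
    proof (induction x rule: frag_induction)
      case (one p)
      then have p: "frag_of p \<in> carrier P" by (simp add: pair_ring_simps)
      have "y \<in> carrier P \<and> h (frag_of p \<otimes>\<^bsub>P\<^esub> y) = h (frag_of p) \<otimes>\<^bsub>D\<^esub> h y"
        using that(2)[unfolded pair_ring_simps]
      proof (induction y rule: frag_induction)
        case (one q)
        then show ?case
          using mult_pair[of "fst p" "snd p" "fst q" "snd q"] \<open>p \<in> ?S\<close>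
          by (auto simp: pair_ring_simps)
      next
        case (diff a b)
        then show ?case
          using p h_closed P.m_closed
          by (simp add: pair_ring_mult_diff h_diff P_diff D.minus_eq D.r_distr D.r_minus)
      qed (use p h_closed in \<open>simp add: P_zero pair_ring_mult_zero h_zero\<close>)
      with p show ?case by simp
    next
      case (diff a b)
      then show ?case
        using that(2) h_closed P.m_closed
        by (simp add: pair_ring_mult_diff h_diff P_diff D.minus_eq D.l_distr D.l_minus)
    qed (use that(2) h_closed in \<open>simp add: P_zero pair_ring_mult_zero h_zero\<close>)
    then show ?thesis ..
  qed
  have h_hom: "h \<in> ring_hom P D"
    by (rule ring_hom_memI)
      (auto simp: h_closed mult h_add pair_ring_simps(2,4) h_pair f_simps g_simps)
  interpret h: ring_hom_ring P D h
    by (intro ring_hom_ringI2 ring_P assms(1) h_hom)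
  have h_rel: "h z = \<zero>\<^bsub>D\<^esub>" if "z \<in> rels" for z
    using that
  proof (cases rule: relator_cases)
    case (left a a' b)
    then show ?thesis
      by (simp add: h_diff P_diff frag_of_closed h_pair f_simps g_simps D.l_distr D.minus_eq D.add.m_ac
          D.r_neg D.r_neg1 D.r_neg2 D.minus_add)
  next
    case (right a b b')
    then show ?thesis
      by (simp add: h_diff P_diff frag_of_closed h_pair f_simps g_simps D.r_distr D.minus_eq D.add.m_ac
          D.r_neg D.r_neg1 D.r_neg2)
  next
    case (scalar r a b)
    have "f (\<alpha> r \<otimes>\<^bsub>A\<^esub> a) \<otimes>\<^bsub>D\<^esub> g b = f a \<otimes>\<^bsub>D\<^esub> g (\<beta> r \<otimes>\<^bsub>B\<^esub> b)"
      using scalar(1-3) agree[of r] comm[of a "\<beta> r"]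
      by (simp add: f_simps g_simps \<alpha>_closed \<beta>_closed flip: D.m_assoc)
    then show ?thesis
      using scalar
      by (simp add: h_diff frag_of_closed h_pair f_simps g_simps \<alpha>_closed \<beta>_closed D.minus_eq D.r_neg)
  qed
  have "rels \<subseteq> a_kernel P D h"
    using rels_subset h_rel unfolding a_kernel_def' by blast
  then have "tensor_ideal R \<alpha> A \<beta> B \<subseteq> a_kernel P D h"
    unfolding tensor_ideal_def by (rule P.genideal_minimal[OF h.kernel_is_ideal])
  then have "h z = \<zero>\<^bsub>D\<^esub>" if "z \<in> tensor_ideal R \<alpha> A \<beta> B" for z
    using that unfolding a_kernel_def' by blast
  from quotient_hom_exists[OF ideal_tensor_ideal assms(1) h_hom this]
  obtain H where "H \<in> ring_hom T D"
    "\<And>x. x \<in> carrier P \<Longrightarrow> H (tensor_ideal R \<alpha> A \<beta> B +>\<^bsub>P\<^esub> x) = h x"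
    unfolding tensor_ring_def by blast
  then show ?thesis
    by (intro that[of H]) (simp_all add: pure_tensor_def frag_of_closed h_pair)
qed

lemma pure_add_right:
  assumes "a \<in> carrier A" "b \<in> carrier B" "b' \<in> carrier B"
  shows "pure a (b \<oplus>\<^bsub>B\<^esub> b') = pure a b \<oplus>\<^bsub>T\<^esub> pure a b'"
proof -
  interpret P: ring P by (rule ring_P)
  have "frag_of (a, b) + frag_of (a, b') \<in> carrier P"
    using P.a_closed[OF frag_of_closed frag_of_closed, of a b a b'] assms
    by (simp add: pair_ring_simps(2))
  then have "pure a (b \<oplus>\<^bsub>B\<^esub> b') =
      tensor_ideal R \<alpha> A \<beta> B +>\<^bsub>P\<^esub> (frag_of (a, b) + frag_of (a, b'))"
    unfolding pure_tensor_def using relator_intros(2)[OF assms] assms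
    by (intro tensor_coset_eqI frag_of_closed) (simp_all add: diff_diff_eq)
  then show ?thesis
    using ring_hom_add[OF tensor_coset_hom, of "frag_of (a, b)" "frag_of (a, b')"] assms
    by (simp add: pure_tensor_def frag_of_closed pair_ring_simps(2))
qed

lemma tensor_induct [consumes 1, case_names pure diff]:
  assumes "V \<in> carrier T"
    and pure: "\<And>a b. a \<in> carrier A \<Longrightarrow> b \<in> carrier B \<Longrightarrow> Q (pure a b)"
    and diff: "\<And>U V. U \<in> carrier T \<Longrightarrow> V \<in> carrier T \<Longrightarrow> Q U \<Longrightarrow> Q V \<Longrightarrow> Q (U \<ominus>\<^bsub>T\<^esub> V)"
  shows "Q V"
proof -
  interpret T: ring T by (rule ring_tensor_ring)
  let ?q = "\<lambda>x. tensor_ideal R \<alpha> A \<beta> B +>\<^bsub>P\<^esub> x"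
  interpret q: ring_hom_ring P T ?q
    by (intro ring_hom_ringI2 ring_P ring_tensor_ring tensor_coset_hom)
  have q_diff: "?q (x - y) = ?q x \<ominus>\<^bsub>T\<^esub> ?q y"
    if "x \<in> carrier P" "y \<in> carrier P" "x - y \<in> carrier P" for x y
  proof -
    have "?q (x - y) \<oplus>\<^bsub>T\<^esub> ?q y = ?q x"
      using q.hom_add[of "x - y" y] that by (simp add: pair_ring_simps(2))
    then show ?thesis
      using q.hom_closed that by (metis T.add.inv_solve_right' T.minus_eq)
  qed
  obtain x where x: "x \<in> carrier P" "V = ?q x"
    using assms(1) by (auto simp: tensor_carrier)
  have "x \<in> carrier P \<and> Q (?q x)"
    using x(1)[unfolded pair_ring_simps]
  proof (induction x rule: frag_induction)
    case zero
    have "pure \<zero>\<^bsub>A\<^esub> \<zero>\<^bsub>B\<^esub> \<ominus>\<^bsub>T\<^esub> pure \<zero>\<^bsub>A\<^esub> \<zero>\<^bsub>B\<^esub> = \<zero>\<^bsub>T\<^esub>"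
      using pure_closed[of "\<zero>\<^bsub>A\<^esub>" "\<zero>\<^bsub>B\<^esub>"] by (simp add: T.r_neg T.minus_eq)
    then have "Q \<zero>\<^bsub>T\<^esub>"
      using diff[OF pure_closed pure_closed pure pure, of "\<zero>\<^bsub>A\<^esub>" "\<zero>\<^bsub>B\<^esub>" "\<zero>\<^bsub>A\<^esub>" "\<zero>\<^bsub>B\<^esub>"] by simp
    then show ?case
      using q.hom_zero by (simp add: pair_ring_simps)
  next
    case (one p)
    then show ?case
      using pure[of "fst p" "snd p"] by (auto simp: pair_ring_simps pure_tensor_def)
  next
    case (diff a b)
    then have "a - b \<in> carrier P"
      using keys_diff[of a b] unfolding pair_ring_simps by blast
    with diff show ?case
      using assms(3)[of "?q a" "?q b"] by (simp add: q_diff)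
  qed
  then show ?thesis using x(2) by simp
qed

lemma pure_tensor_central:
  assumes "a \<in> carrier A" "\<And>a'. a' \<in> carrier A \<Longrightarrow> a \<otimes>\<^bsub>A\<^esub> a' = a' \<otimes>\<^bsub>A\<^esub> a"
    and "b \<in> carrier B" "\<And>b'. b' \<in> carrier B \<Longrightarrow> b \<otimes>\<^bsub>B\<^esub> b' = b' \<otimes>\<^bsub>B\<^esub> b"
    and "V \<in> carrier T"
  shows "pure a b \<otimes>\<^bsub>T\<^esub> V = V \<otimes>\<^bsub>T\<^esub> pure a b"
proof -
  interpret T: ring T by (rule ring_tensor_ring)
  show ?thesis
    using assms(5)
  proof (induction V rule: tensor_induct)
    case (diff U V)
    then show ?case
      using pure_closed[OF assms(1,3)]
      by (simp add: T.minus_eq T.l_distr T.r_distr T.l_minus T.r_minus)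
  qed (simp add: pure_mult assms)
qed

end

section \<open>Rescaling generators by powers of \<open>C\<^sup>1\<^sup>/\<^sup>2\<close>\<close>

text \<open>
  In \<open>\<tau> x n\<close> the index \<open>n\<close> is the exponent of \<open>C\<^sup>1\<^sup>/\<^sup>2\<close>, so \<open>\<tau> x n\<close> is thought of as \<open>x C\<^sup>n\<^sup>/\<^sup>2\<close>
  in the target algebra. The letter \<open>Z\<close> goes to the \<open>a\<close>-th power of \<open>C\<^sup>1\<^sup>/\<^sup>2\<close>, and the sign
  \<open>e\<close> tells the direction of the rescaling of the \<open>H\<close>.
\<close>

definition gen_image :: "('i falg \<Rightarrow> int \<Rightarrow> 'a) \<Rightarrow> int \<Rightarrow> int \<Rightarrow> 'i gen \<Rightarrow> 'a"
  where "gen_image \<tau> a e g = (case g of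
      Z \<Rightarrow> \<tau> 1 a
    | Z_inv \<Rightarrow> \<tau> 1 (- a)
    | H_Suc i m \<Rightarrow> \<tau> (letter g) (e * (int m + 1))
    | _ \<Rightarrow> \<tau> (letter g) 0)"

text \<open>
  The homomorphism \<open>h\<close> goes from the free algebra of the source presentation to an algebra \<open>A\<close> in which
  the relations \<open>rel\<close> of the target presentation hold. The letter \<open>Z\<close> is the \<open>a\<close>-th power of
  \<open>C\<^sup>1\<^sup>/\<^sup>2\<close> in the source and the \<open>b\<close>-th power in the target, so \<open>(a, b, e)\<close> is \<open>(1, 2, -1)\<close> in one
  direction and \<open>(2, 1, 1)\<close> in the other.

  The lemmas below are the rules of a calculus for statements of the form \<open>h x = \<tau> x' n\<close>: the
  expression \<open>x\<close> of the source becomes the expression \<open>x'\<close> of the target times \<open>C\<^sup>n\<^sup>/\<^sup>2\<close>. In many of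
  them \<open>x\<close> and \<open>x'\<close> are the same expression, which is then homogeneous of degree \<open>e n\<close>.
\<close>

locale rescaling = assoc_algebra "ring_of_type_algebra :: qv ring" A
  for A :: "(qv, 'a, 'n) module_scheme" (structure) +
  fixes rel :: "'i falg \<Rightarrow> 'i falg \<Rightarrow> bool"
    and \<tau> :: "'i falg \<Rightarrow> int \<Rightarrow> 'a" and a b e :: int and h :: "'i falg \<Rightarrow> 'a"
  assumes \<tau>_closed: "\<tau> x n \<in> carrier A"
    and \<tau>_cong: "rel x y \<Longrightarrow> \<tau> x n = \<tau> y n"
    and \<tau>_add: "\<tau> (x + y) n = \<tau> x n \<oplus>\<^bsub>A\<^esub> \<tau> y n"
    and \<tau>_mult: "\<tau> (x * y) (m + n) = \<tau> x m \<otimes>\<^bsub>A\<^esub> \<tau> y n"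
    and \<tau>_scalar: "\<tau> (scalar q) 0 = q \<odot>\<^bsub>A\<^esub> \<one>\<^bsub>A\<^esub>"
    and \<tau>_shift: "\<tau> (x * xZ k) n = \<tau> x (n + b * k)"
    and \<tau>_Z_commute: "\<tau> (xZ k * x) n = \<tau> (x * xZ k) n"
    and \<tau>_K_commute: "\<tau> (xK i * x) n = \<tau> (x * xK i) n"
    and h_hom: "h \<in> ring_hom ring_of_type_algebra A"
    and h_scalar_one: "h (scalar q) = q \<odot>\<^bsub>A\<^esub> \<one>\<^bsub>A\<^esub>"
    and h_letter: "h (letter g) = gen_image \<tau> a e g"
begin

lemma h_closed: "h x \<in> carrier A"
  using ring_hom_closed[OF h_hom] by simp

lemma h_add_eq: "h (x + y) = h x \<oplus>\<^bsub>A\<^esub> h y"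
  using ring_hom_add[OF h_hom] by simp

lemma h_mult_eq: "h (x * y) = h x \<otimes>\<^bsub>A\<^esub> h y"
  using ring_hom_mult[OF h_hom] by simp

lemma h_one_eq: "h 1 = \<one>\<^bsub>A\<^esub>"
  using ring_hom_one[OF h_hom] by simp

lemma h_scalar: "h (scalar k) = \<tau> (scalar k) 0"
  by (simp add: h_scalar_one \<tau>_scalar)

lemma \<tau>_one: "\<tau> 1 0 = \<one>\<^bsub>A\<^esub>"
  using h_scalar[of 1] by (simp add: scalar_one h_one_eq)

lemma \<tau>_zero: "\<tau> 0 n = \<zero>\<^bsub>A\<^esub>"
  using \<tau>_add[of 0 0 n] \<tau>_closed[of 0 n] M.add.l_cancel_one'[of "\<tau> 0 n" "\<tau> 0 n"] by simp

lemma h_zero: "h 0 = \<tau> 0 n"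
  using h_add_eq[of 0 0] h_closed[of 0] M.add.l_cancel_one'[of "h 0" "h 0"] by (simp add: \<tau>_zero)

lemma h_K: "h (xK i) = \<tau> (xK i) 0" and h_K_inv: "h (xK_inv i) = \<tau> (xK_inv i) 0"
  and h_B: "h (xB i l) = \<tau> (xB i l) 0"
  by (simp_all add: xK_def xK_inv_def xB_def h_letter gen_image_def)

lemma h_H: "m \<ge> 1 \<Longrightarrow> h (xH i m) = \<tau> (xH i m) (e * int m)"
  by (simp add: xH_def h_letter gen_image_def of_nat_diff)

lemma h_add: "h x = \<tau> x' n \<Longrightarrow> h y = \<tau> y' n \<Longrightarrow> h (x + y) = \<tau> (x' + y') n"
  by (simp add: h_add_eq \<tau>_add)

lemma h_diff:
  assumes "h x = \<tau> x' n" "h y = \<tau> y' n"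
  shows "h (x - y) = \<tau> (x' - y') n"
proof -
  have "h (x - y) \<oplus>\<^bsub>A\<^esub> h y = \<tau> (x' - y') n \<oplus>\<^bsub>A\<^esub> h y"
    using assms h_add_eq[of "x - y" y] \<tau>_add[of "x' - y'" y' n] by simp
  then show ?thesis
    by (simp add: h_closed \<tau>_closed)
qed

lemma h_uminus: "h x = \<tau> x' n \<Longrightarrow> h (- x) = \<tau> (- x') n"
  using h_diff[OF h_zero, of x x' n] by simp

lemma h_sum: "(\<And>p. p \<in> S \<Longrightarrow> h (f p) = \<tau> (f' p) n) \<Longrightarrow> h (\<Sum>p\<in>S. f p) = \<tau> (\<Sum>p\<in>S. f' p) n"
  by (induction S rule: infinite_finite_induct) (simp_all add: h_zero[of n] h_add)

text \<open>
  The exponent \<open>d\<close> is a variable of its own so that the rule applies backwards to any given exponent.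
\<close>

lemma h_mult:
  "h x = \<tau> x' m \<Longrightarrow> h y = \<tau> y' n \<Longrightarrow> d = m + n \<Longrightarrow> h (x * y) = \<tau> (x' * y') d"
  by (simp add: h_mult_eq \<tau>_mult)

lemma h_scalar_mult: "h x = \<tau> x' n \<Longrightarrow> h (scalar k * x) = \<tau> (scalar k * x') n"
  by (rule h_mult[OF h_scalar]) simp_all

lemma h_comm:
  "h x = \<tau> x' m \<Longrightarrow> h y = \<tau> y' n \<Longrightarrow> d = m + n \<Longrightarrow> h (comm x y) = \<tau> (comm x' y') d"
  unfolding comm_def by (intro h_diff h_mult[of x x' m y y' n] h_mult[of y y' n x x' m]) simp_all

lemma h_vcomm:
  "h x = \<tau> x' m \<Longrightarrow> h y = \<tau> y' n \<Longrightarrow> d = m + n \<Longrightarrow> h (vcomm k x y) = \<tau> (vcomm k x' y') d"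
  unfolding vcomm_def
  by (intro h_diff h_scalar_mult h_mult[of x x' m y y' n] h_mult[of y y' n x x' m]) simp_all

lemma h_Z: "h (xZ k) = \<tau> 1 (a * k)"
proof -
  have "h (letter g ^ n) = \<tau> 1 (s * int n)" if "h (letter g) = \<tau> 1 s" for g s n
  proof (induction n)
    case 0
    then show ?case by (simp add: h_one_eq \<tau>_one)
  next
    case (Suc n)
    then show ?case
      using h_mult[OF that Suc, of "s * int (Suc n)"] by (simp add: algebra_simps)
  qed
  from this[of Z a] this[of Z_inv "- a"] show ?thesis
    by (simp add: xZ_def h_letter gen_image_def)
qed

text \<open>
  Powers of \<open>Z\<close> are central, so in the target they can be traded for the index of \<open>\<tau>\<close>. The premise
  compares the total exponents of \<open>C\<^sup>1\<^sup>/\<^sup>2\<close> on the two sides.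
\<close>

lemma h_Z_between:
  assumes "h x = \<tau> x' m" "h y = \<tau> y' n" "d + b * k' = m + n + a * k"
  shows "h (x * xZ k * y) = \<tau> (x' * xZ k' * y') d"
proof -
  have "h (x * xZ k * y) = \<tau> (x' * 1 * y') (m + a * k + n)"
    by (rule h_mult[OF h_mult[OF assms(1) h_Z refl] assms(2) refl])
  also have "\<dots> = \<tau> (x' * y' * xZ k') d"
    by (simp add: \<tau>_shift assms(3) add_ac)
  \<comment> \<open>Splitting the exponent as \<open>0 + d\<close> isolates the second factor, which contains \<open>Z\<close>.\<close>
  also have "\<dots> = \<tau> (x' * (y' * xZ k')) (0 + d)"
    by (simp add: mult.assoc)
  also have "\<dots> = \<tau> (x' * (xZ k' * y')) (0 + d)"
    unfolding \<tau>_mult \<tau>_Z_commute ..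
  finally show ?thesis
    by (simp add: mult.assoc)
qed

lemma h_Z_right:
  assumes "h x = \<tau> x' m" "d + b * k' = m + a * k"
  shows "h (x * xZ k) = \<tau> (x' * xZ k') d"
  using h_Z_between[OF assms(1) h_scalar[of 1], of d k' k] assms(2) by (simp add: scalar_one)

text \<open>
  The coefficient of \<open>u\<^sup>n\<close> in a power of \<open>\<Sum> H\<^sub>m u\<^sup>m\<close> is a sum of words in the \<open>H\<close> of
  total degree \<open>n\<close>; this holds in the free algebra, where the \<open>H\<close> do not commute.
\<close>

lemma h_H_series_power:
  "h (fps_nth (H_series i ^ k) n) = \<tau> (fps_nth (H_series i ^ k) n) (e * int n)"
proof (induction k arbitrary: n)
  case 0
  then show ?case
    using h_scalar[of 1] h_zero by (simp add: scalar_one)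
next
  case (Suc k)
  have "h (fps_nth (H_series i) m) = \<tau> (fps_nth (H_series i) m) (e * int m)" for m
    by (cases "m = 0") (simp_all add: H_series_def h_zero[of 0] h_scalar_mult h_H)
  then show ?case
    unfolding power_Suc fps_mult_nth
    by (intro h_sum h_mult[OF _ Suc]) (auto simp: algebra_simps)
qed

lemma h_Theta: "h (xTheta i r) = \<tau> (xTheta i r) (e * r)"
proof (cases "r > 0")
  case True
  define n where "n = nat r"
  have "h (fps_nth (exp_series (H_series i)) n) = \<tau> (fps_nth (exp_series (H_series i)) n) (e * int n)"
    unfolding exp_series_def fps_nth_Abs_fps
    by (intro h_sum h_scalar_mult h_H_series_power)
  with True show ?thesis
    by (simp add: xTheta_def n_def h_scalar_mult)
qed (auto simp: xTheta_def h_scalar intro: h_zero)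

text \<open>
  The two presentations write the factors of a term \<open>\<Theta> C\<^sup>k K\<close> in opposite orders.
\<close>

lemma h_Z_between_Theta:
  assumes "d + b * k' = a * k + e * r"
  shows "h (xTheta i r * xZ k * xK i) = \<tau> (xK i * xZ k' * xTheta i r) d"
    and "h (xK i * xZ k * xTheta i r) = \<tau> (xTheta i r * xZ k' * xK i) d"
proof -
  have swap: "\<tau> (xTheta i r * xZ k' * xK i) d = \<tau> (xK i * xZ k' * xTheta i r) d"
  proof -
    have "\<tau> (xTheta i r * xZ k' * xK i) d = \<tau> (xK i * (xTheta i r * xZ k')) (0 + d)"
      by (simp add: \<tau>_K_commute)
    also have "\<dots> = \<tau> (xK i * (xZ k' * xTheta i r)) (0 + d)"
      unfolding \<tau>_mult \<tau>_Z_commute ..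
    finally show ?thesis by (simp add: mult.assoc)
  qed
  show "h (xTheta i r * xZ k * xK i) = \<tau> (xK i * xZ k' * xTheta i r) d"
    unfolding swap[symmetric] by (rule h_Z_between[OF h_Theta h_K]) (use assms in simp)
  show "h (xK i * xZ k * xTheta i r) = \<tau> (xTheta i r * xZ k' * xK i) d"
    unfolding swap by (rule h_Z_between[OF h_K h_Theta]) (use assms in simp)
qed

lemma h_serre: "h (serre i j k1 k2 l) = \<tau> (serre i j k1 k2 l) 0"
  unfolding serre_def by (intro h_add h_diff h_scalar_mult h_mult[where m = 0 and n = 0] h_B) simp_all

lemma h_eqI: "h x = \<tau> x' n \<Longrightarrow> h y = \<tau> y' n \<Longrightarrow> rel x' y' \<Longrightarrow> h x = h y"
  using \<tau>_cong by simp

end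

lemma v_neq: "v \<noteq> 0" "v - inverse v \<noteq> 0"
proof -
  show "v \<noteq> 0" by (simp add: v_def)
  have "v * v \<noteq> 1"
  proof
    assume "v * v = 1"
    then have "to_fract ([:0, 1:] * [:0, 1:] :: rat poly) = to_fract 1"
      by (simp only: v_def to_fract_mult to_fract_1)
    then show False by (simp add: one_pCons)
  qed
  then show "v - inverse v \<noteq> 0"
    using \<open>v \<noteq> 0\<close> by (simp add: field_simps)
qed

lemma vint_2: "v powi (-1) * vint 2 = 1 + v powi (-2)"
proof -
  have "v powi 2 - v powi (-2) = (v + inverse v) * (v - inverse v)"
    using v_neq(1) by (simp add: field_simps power2_eq_square power_int_minus)
  then have "vint 2 = v + inverse v"
    using v_neq(2) by (simp add: vint_def)
  then show ?thesis
    using v_neq(1) by (simp add: field_simps power2_eq_square power_int_minus)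
qed

lemma xZ_zero: "xZ 0 = 1"
  by (simp add: xZ_def)

lemma xTheta_negative: "r < 0 \<Longrightarrow> xTheta i r = 0"
  by (simp add: xTheta_def)

lemma vcomm_zero: "vcomm k 0 y = 0" "vcomm k x 0 = 0"
  by (simp_all add: vcomm_def)

text \<open>
  A common form of the right-hand sides of the two Serre relations. They differ in the powers of \<open>Z\<close>
  only, which are the parameters \<open>s\<close>, \<open>u\<close> and \<open>w\<close>; \<open>d\<close> stands for \<open>k\<^sub>2 - k\<^sub>1\<close>. For \<open>p > d\<close> the
  indices of the \<open>\<Theta>\<close> are negative, hence the bounds of the sums.
\<close>

definition serre_rhs ::
  "'i \<Rightarrow> 'i \<Rightarrow> int \<Rightarrow> int \<Rightarrow> int \<Rightarrow> (nat \<Rightarrow> int) \<Rightarrow> (nat \<Rightarrow> int) \<Rightarrow> 'i falg"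
  where "serre_rhs i j l d s u w =
    xK i * xZ s *
    (- (\<Sum>p<Suc (nat d). scalar (v powi (2 * int p) * vint 2) *
          vcomm (-2) (xTheta i (d - 2 * int p - 1)) (xB j (l - 1)) * xZ (u p))
     - (\<Sum>p=1..<Suc (nat d). scalar (v powi (2 * int p - 1) * vint 2) *
          vcomm (-2) (xB j l) (xTheta i (d - 2 * int p)) * xZ (w p))
     - vcomm (-2) (xB j l) (xTheta i d))"

lemma Dr_rhs_eq: "Dr_rhs i j k1 k2 l = serre_rhs i j l (k2 - k1) k1 (\<lambda>p. int p + 1) int"
proof -
  let ?F = "\<lambda>p. scalar (v powi (2 * int p) * vint 2) *
    vcomm (-2) (xTheta i (k2 - k1 - 2 * int p - 1)) (xB j (l - 1)) * xZ (int p + 1)"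
  let ?G = "\<lambda>p. scalar (v powi (2 * int p - 1) * vint 2) *
    vcomm (-2) (xB j l) (xTheta i (k2 - k1 - 2 * int p)) * xZ (int p)"
  let ?N = "Suc (nat (k2 - k1))"
  have F0: "?F p \<noteq> 0 \<Longrightarrow> p < ?N" and G0: "?G p \<noteq> 0 \<Longrightarrow> p < ?N" for p
    by (rule ccontr, simp add: xTheta_negative vcomm_zero)+
  have F: "Sum_any ?F = (\<Sum>p<?N. ?F p)"
    using F0 by (intro Sum_any.expand_superset) auto
  have "Sum_any (\<lambda>p. ?G p when p \<ge> 1) = (\<Sum>p=1..<?N. ?G p when p \<ge> 1)"
    using G0 by (intro Sum_any.expand_superset) (auto simp: when_def split: if_splits)
  also have "\<dots> = (\<Sum>p=1..<?N. ?G p)"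
    by (intro sum.cong) (auto simp: when_def)
  finally have G: "Sum_any (\<lambda>p. ?G p when p \<ge> 1) = (\<Sum>p=1..<?N. ?G p)" .
  show ?thesis
    unfolding Dr_rhs_def serre_rhs_def F G ..
qed

text \<open>
  The summand for \<open>p = 0\<close> of the second sum is \<open>v\<^sup>-\<^sup>1 [2] Y = Y + v\<^sup>-\<^sup>2 Y\<close>, where \<open>Y\<close> is the twisted
  commutator of the last term; its second part cancels against that term.
\<close>

lemma DR_rhs_eq: "DR_rhs i j k1 k2 l = serre_rhs i j l (k2 - k1) (k1 + k2) (\<lambda>_. 1) (\<lambda>_. 0)"
proof -
  let ?F = "\<lambda>p. scalar (v powi (2 * int p) * vint 2) *
    vcomm (-2) (xTheta i (k2 - k1 - 2 * int p - 1)) (xB j (l - 1)) * xZ 1"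
  let ?G = "\<lambda>p. scalar (v powi (2 * int p - 1) * vint 2) *
    vcomm (-2) (xB j l) (xTheta i (k2 - k1 - 2 * int p))"
  let ?Y = "vcomm (-2) (xB j l) (xTheta i (k2 - k1))"
  let ?N = "Suc (nat (k2 - k1))"
  have F0: "?F p \<noteq> 0 \<Longrightarrow> p < ?N" and G0: "?G p \<noteq> 0 \<Longrightarrow> p < ?N" for p
    by (rule ccontr, simp add: xTheta_negative vcomm_zero)+
  have F: "Sum_any ?F = (\<Sum>p<?N. ?F p)"
    using F0 by (intro Sum_any.expand_superset) auto
  have "Sum_any ?G = (\<Sum>p<?N. ?G p)"
    using G0 by (intro Sum_any.expand_superset) auto
  also have "\<dots> = ?G 0 + (\<Sum>p=1..<?N. ?G p)"
    by (simp only: lessThan_atLeast0 sum.atLeast_Suc_lessThan[OF zero_less_Suc] One_nat_def)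
  also have "?G 0 = ?Y + scalar (v powi (-2)) * ?Y"
    using vint_2 by (simp add: scalar_add scalar_one distrib_right)
  finally have G: "Sum_any ?G = ?Y + scalar (v powi (-2)) * ?Y + (\<Sum>p=1..<?N. ?G p)" .
  have cancel: "- S - (Y + Y' + S') + Y' = - S - S' - Y" for S S' Y Y' :: "'a falg"
    by simp
  show ?thesis
    unfolding DR_rhs_def serre_rhs_def F G cancel xZ_zero mult_1_right ..
qed

context rescaling
begin

text \<open>
  Inside the bracket every term has the same degree as \<open>\<Theta>\<^sub>d\<close>. Lowering the index of \<open>\<Theta>\<close> by
  \<open>2 p + 1\<close> or \<open>2 p\<close> is compensated by the change of the exponents \<open>u\<close> and \<open>w\<close>.
\<close>

lemma h_serre_rhs:
  assumes u: "\<And>p. b * u' p = a * u p - e * (2 * int p + 1)"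
    and w: "\<And>p. b * w' p = a * w p - e * (2 * int p)"
    and s: "b * s' = a * s + e * d"
  shows "h (serre_rhs i j l d s u w) = \<tau> (serre_rhs i j l d s' u' w') 0"
  unfolding serre_rhs_def
proof (intro h_Z_between[where m = 0 and n = "e * d", OF h_K] h_diff h_uminus h_sum)
  show "h (vcomm (-2) (xB j l) (xTheta i d)) = \<tau> (vcomm (-2) (xB j l) (xTheta i d)) (e * d)"
    by (rule h_vcomm[OF h_B h_Theta]) simp
  show "h (scalar q * vcomm (-2) (xTheta i (d - 2 * int p - 1)) (xB j (l - 1)) * xZ (u p)) =
      \<tau> (scalar q * vcomm (-2) (xTheta i (d - 2 * int p - 1)) (xB j (l - 1)) * xZ (u' p)) (e * d)"
    for p q
    by (rule h_Z_right[OF h_scalar_mult[OF h_vcomm[OF h_Theta h_B refl]]])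
      (use u[of p] in \<open>simp add: algebra_simps\<close>)
  show "h (scalar q * vcomm (-2) (xB j l) (xTheta i (d - 2 * int p)) * xZ (w p)) =
      \<tau> (scalar q * vcomm (-2) (xB j l) (xTheta i (d - 2 * int p)) * xZ (w' p)) (e * d)"
    for p q
    by (rule h_Z_right[OF h_scalar_mult[OF h_vcomm[OF h_B h_Theta refl]]])
      (use w[of p] in \<open>simp add: algebra_simps\<close>)
qed (use s in simp)

text \<open>
  The exponents \<open>r\<close> and \<open>s\<close> are left open since \<open>B\<^sub>j\<^sub>,\<^sub>l\<^sub>+\<^sub>m\<close> has the factor \<open>1\<close> in one presentation
  and \<open>C\<^sup>-\<^sup>m\<^sup>/\<^sup>2\<close> in the other.
\<close>

lemma h_HB:
  assumes "m \<ge> 1" "b * r' = a * r - e * int m" "b * s' = a * s - e * int m"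
  shows "h (comm (xH i m) (xB j l)) = \<tau> (comm (xH i m) (xB j l)) (e * int m)"
    and "h (scalar q * (xB j (l + int m) * xZ r) - scalar q * (xB j (l - int m) * xZ s)) =
      \<tau> (scalar q * (xB j (l + int m) * xZ r') - scalar q * (xB j (l - int m) * xZ s')) (e * int m)"
proof -
  show "h (comm (xH i m) (xB j l)) = \<tau> (comm (xH i m) (xB j l)) (e * int m)"
    by (rule h_comm[OF h_H[OF assms(1)] h_B]) simp
  show "h (scalar q * (xB j (l + int m) * xZ r) - scalar q * (xB j (l - int m) * xZ s)) =
      \<tau> (scalar q * (xB j (l + int m) * xZ r') - scalar q * (xB j (l - int m) * xZ s')) (e * int m)"
    by (intro h_diff h_scalar_mult h_Z_right[OF h_B]) (use assms in simp_all)
qed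

lemma h_HH:
  assumes "m \<ge> 1" "n \<ge> 1"
  shows "h (comm (xH i m) (xH j n)) = \<tau> (comm (xH i m) (xH j n)) (e * (int m + int n))"
  by (rule h_comm[OF h_H[OF assms(1)] h_H[OF assms(2)]]) (simp add: algebra_simps)

lemma h_BB_comm: "h (comm (xB i k) (xB j l)) = \<tau> (comm (xB i k) (xB j l)) 0"
  by (rule h_comm[OF h_B h_B]) simp

lemma h_BB_vcomm:
  "h (vcomm r (xB i k) (xB j l) - scalar q * vcomm r' (xB i k') (xB j l')) =
    \<tau> (vcomm r (xB i k) (xB j l) - scalar q * vcomm r' (xB i k') (xB j l')) 0"
  by (intro h_diff h_scalar_mult h_vcomm[OF h_B h_B]) simp_all

end

section \<open>From the first presentation to the second\<close>

lemma DR_Z_central: "coset (DR_rel c) (xZ n * x) = coset (DR_rel c) (x * xZ n)"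
proof -
  have "coset (DR_rel c) (z ^ n * x) = coset (DR_rel c) (x * z ^ n)"
    if "\<And>x. coset (DR_rel c) (z * x) = coset (DR_rel c) (x * z)" for z x and n :: nat
  proof (induction n arbitrary: x)
    case (Suc n)
    have "coset (DR_rel c) (z ^ Suc n * x) = coset (DR_rel c) (z * (z ^ n * x))"
      by (simp add: mult.assoc)
    also have "\<dots> = coset (DR_rel c) (z ^ n * (x * z))"
      by (simp add: that mult.assoc)
    also have "\<dots> = coset (DR_rel c) (x * z ^ Suc n)"
      by (simp add: Suc mult.assoc)
    finally show ?case .
  qed simp
  then show ?thesis
    using coset_eqI[of "DR_rel c", OF DR_rel.C_central] coset_eqI[of "DR_rel c", OF DR_rel.C_inv_central]
    by (simp add: xZ_def)
qed

text \<open>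
  Differences of natural numbers avoid the distinction of signs in the definition of \<^const>\<open>xZ\<close>.
\<close>

lemma DR_Z_powers:
  "coset (DR_rel c) (xZ (int p - int q)) = coset (DR_rel c) (letter Z ^ p * letter Z_inv ^ q)"
proof (induction p q rule: diff_induct)
  case (3 p q)
  have "coset (DR_rel c) (letter Z ^ p * letter Z_inv ^ q) =
      coset (DR_rel c) (letter Z ^ p * ((letter Z * letter Z_inv) * letter Z_inv ^ q))"
    using coset_mult_cong[OF refl coset_mult_cong[OF coset_eqI[of "DR_rel c", OF DR_rel.C_inverse] refl]]
    by (simp add: xZ_def)
  also have "letter Z ^ p * ((letter Z * letter Z_inv) * letter Z_inv ^ q) =
      letter Z ^ Suc p * (letter Z_inv ^ Suc q :: 'a falg)"
    by (simp only: power_Suc2[of "letter Z"] power_Suc[of "letter Z_inv"] mult.assoc)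
  finally show ?case
    using 3 by simp
qed (simp_all add: xZ_def del: of_nat_Suc)

lemma DR_Z_add: "coset (DR_rel c) (xZ (m + n)) = coset (DR_rel c) (xZ m * xZ n)"
proof -
  have "\<exists>p q. k = int p - int q" for k
    using int_diff_cases[of k] by metis
  then obtain p q p' q' where mn: "m = int p - int q" "n = int p' - int q'"
    by metis
  have "coset (DR_rel c) (xZ m * xZ n) =
      coset (DR_rel c) ((letter Z ^ p * letter Z_inv ^ q) * (letter Z ^ p' * letter Z_inv ^ q'))"
    unfolding mn by (intro coset_mult_cong DR_Z_powers)
  also have "\<dots> = coset (DR_rel c) (letter Z ^ p * (xZ (- int q) * (letter Z ^ p' * letter Z_inv ^ q')))"
    by (simp add: xZ_def mult.assoc)
  also have "\<dots> = coset (DR_rel c) (letter Z ^ p * (letter Z ^ p' * letter Z_inv ^ q' * xZ (- int q)))"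
    by (intro coset_mult_cong refl DR_Z_central)
  also have "\<dots> = coset (DR_rel c) (letter Z ^ (p + p') * letter Z_inv ^ (q' + q))"
    by (simp add: xZ_def power_add mult.assoc)
  also have "\<dots> = coset (DR_rel c) (xZ (m + n))"
    unfolding DR_Z_powers[symmetric] mn by (simp add: algebra_simps)
  finally show ?thesis ..
qed

lemma DR_alg_simps:
  "carrier (DR_alg c) = range (coset (DR_rel c))"
  "coset (DR_rel c) x \<otimes>\<^bsub>DR_alg c\<^esub> coset (DR_rel c) y = coset (DR_rel c) (x * y)"
  "coset (DR_rel c) x \<oplus>\<^bsub>DR_alg c\<^esub> coset (DR_rel c) y = coset (DR_rel c) (x + y)"
  "\<one>\<^bsub>DR_alg c\<^esub> = coset (DR_rel c) 1"
  "k \<odot>\<^bsub>DR_alg c\<^esub> coset (DR_rel c) x = coset (DR_rel c) (scalar k * x)"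
  by (simp_all add: DR_alg_def presented_algebra_simps)

abbreviation (input) DR_shift :: "('i \<Rightarrow> 'i \<Rightarrow> int) \<Rightarrow> 'i falg \<Rightarrow> int \<Rightarrow> 'i falg set"
  where "DR_shift c x n \<equiv> coset (DR_rel c) (x * xZ n)"

lemma DR_shift_mult: "DR_shift c (x * y) (m + n) = DR_shift c x m \<otimes>\<^bsub>DR_alg c\<^esub> DR_shift c y n"
proof -
  have "DR_shift c (x * y) (m + n) = coset (DR_rel c) (x * y * (xZ m * xZ n))"
    by (intro coset_mult_cong refl DR_Z_add)
  also have "\<dots> = coset (DR_rel c) (x * (y * xZ m) * xZ n)"
    by (simp add: mult.assoc)
  also have "\<dots> = coset (DR_rel c) (x * (xZ m * y) * xZ n)"
    by (intro coset_mult_cong refl DR_Z_central[symmetric])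
  finally show ?thesis
    by (simp add: DR_alg_simps mult.assoc)
qed

lemma Dr_to_DR_rescaling:
  assumes "h \<in> ring_hom ring_of_type_algebra (DR_alg c)"
    and "\<And>g. h (letter g) = gen_image (DR_shift c) 2 1 g"
    and "\<And>k. h (scalar k) = k \<odot>\<^bsub>DR_alg c\<^esub> \<one>\<^bsub>DR_alg c\<^esub>"
  shows "rescaling (DR_alg c) (DR_rel c) (DR_shift c) 2 1 1 h"
proof (intro rescaling.intro rescaling_axioms.intro assoc_algebra_DR assms)
  show "DR_rel c x y \<Longrightarrow> DR_shift c x n = DR_shift c y n" for x y n
    by (intro coset_mult_cong coset_eqI refl)
  show "DR_shift c (x * y) (m + n) = DR_shift c x m \<otimes>\<^bsub>DR_alg c\<^esub> DR_shift c y n" for x y m n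
    by (rule DR_shift_mult)
  show "DR_shift c (x * xZ k) n = DR_shift c x (n + 1 * k)" for x k n
  proof -
    have "DR_shift c (x * xZ k) n = coset (DR_rel c) (x * (xZ k * xZ n))"
      by (simp add: mult.assoc)
    also have "\<dots> = coset (DR_rel c) (x * xZ (k + n))"
      by (intro coset_mult_cong refl DR_Z_add[symmetric])
    finally show ?thesis by (simp add: add.commute)
  qed
  show "DR_shift c (xZ k * x) n = DR_shift c (x * xZ k) n" for k x n
    by (intro coset_mult_cong refl DR_Z_central)
  show "DR_shift c (xK i * x) n = DR_shift c (x * xK i) n" for i x n
    by (intro coset_mult_cong refl coset_eqI DR_rel.K_central)
qed (simp_all add: DR_alg_simps distrib_right xZ_def)

text \<open>
  A common form of the right-hand sides of the relations between \<open>B\<^sub>i\<^sub>,\<^sub>k\<close> and \<open>B\<^sub>i\<^sub>,\<^sub>l\<close>: the term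
  \<open>t s r\<close> involves \<open>\<Theta>\<^sub>r\<close> and, in the first presentation, \<open>C\<^sup>s\<close>. In all four terms
  \<open>2 s + r = k + l + 1\<close>, which explains the exponent of \<open>C\<^sup>1\<^sup>/\<^sup>2\<close> in the second presentation.
\<close>

definition BB_rhs :: "(int \<Rightarrow> int \<Rightarrow> 'i falg) \<Rightarrow> int \<Rightarrow> int \<Rightarrow> 'i falg"
  where "BB_rhs t k l =
    scalar (v powi (-2)) * t k (l - k + 1) - scalar (v powi (-4)) * t (k + 1) (l - k - 1)
    + scalar (v powi (-2)) * t l (k - l + 1) - scalar (v powi (-4)) * t (l + 1) (k - l - 1)"

lemma DR_BB_rhs:
  "xK i * xZ (k + l + 1) *
      (scalar (v powi (-2)) * xTheta i (l - k + 1) - scalar (v powi (-4)) * xTheta i (l - k - 1)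
       + scalar (v powi (-2)) * xTheta i (k - l + 1) - scalar (v powi (-4)) * xTheta i (k - l - 1)) =
   BB_rhs (\<lambda>_ r. xK i * xZ (k + l + 1) * xTheta i r) k l"
proof -
  have "x * (scalar q * y) = scalar q * (x * y)" for x y :: "'a falg" and q
    by (simp only: mult.assoc[symmetric] scalar_central[of q x])
  then show ?thesis
    by (simp add: BB_rhs_def distrib_left right_diff_distrib)
qed

context rescaling
begin

lemma h_BB_rhs:
  assumes "\<And>s r. 2 * s + r = k + l + 1 \<Longrightarrow> h (t s r) = \<tau> (t' s r) 0"
  shows "h (BB_rhs t k l) = \<tau> (BB_rhs t' k l) 0"
  unfolding BB_rhs_def by (intro h_diff h_add h_scalar_mult assms) simp_all

end

lemma Dr_to_DR_respects_relations:
  assumes h: "h \<in> ring_hom ring_of_type_algebra (DR_alg c)"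
    "\<And>g. h (letter g) = gen_image (DR_shift c) 2 1 g"
    "\<And>k. h (scalar k) = k \<odot>\<^bsub>DR_alg c\<^esub> \<one>\<^bsub>DR_alg c\<^esub>"
    and "Dr_rel c x y"
  shows "h x = h y"
proof -
  interpret rescaling "DR_alg c" "DR_rel c" "DR_shift c" 2 1 1 h
    by (rule Dr_to_DR_rescaling[OF h])
  have image: "\<exists>y. h x = coset (DR_rel c) y" for x
    using h_closed[of x] by (auto simp: DR_alg_simps)
  show ?thesis
    using assms(4)
  proof cases
    case (K_central i z)
    obtain z' where "h z = coset (DR_rel c) z'" using image by blast
    then show ?thesis
      using coset_eqI[of "DR_rel c", OF DR_rel.K_central[of c i z']]
      by (simp add: K_central h_mult_eq h_K DR_alg_simps xZ_def)
  next
    case (C_central z)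
    obtain z' where "h z = coset (DR_rel c) z'" using image by blast
    then show ?thesis
      by (simp add: C_central h_mult_eq h_Z DR_alg_simps DR_Z_central)
  next
    case (HH m n i j)
    then show ?thesis
      using h_eqI[OF h_HH h_zero DR_rel.HH] by simp
  next
    case (K_inverse i)
    show ?thesis
      unfolding K_inverse
      by (rule h_eqI[OF h_mult[OF h_K h_K_inv refl] _ DR_rel.K_inverse])
        (simp add: h_one_eq DR_alg_simps xZ_zero)
  next
    case C_inverse
    show ?thesis
      using h_mult[OF h_Z h_Z refl, of 1 "-1"]
      by (simp add: C_inverse h_one_eq DR_alg_simps xZ_zero)
  next
    case (HB m i j l)
    show ?thesis
      using h_HB(2)[of m "- int m" 0 "int m" "int m" "vint (int m * c i j) / of_nat m" j l] HB(3)
      unfolding HB(1,2) xZ_zero mult_1_right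
      by (intro h_eqI[OF h_HB(1)[of m "- int m" 0 "int m" "int m"] _ DR_rel.HB[OF HB(3)]]) simp_all
  next
    case (BB_zero i j k l)
    show ?thesis
      unfolding BB_zero
      by (rule h_eqI[OF h_BB_comm h_zero DR_rel.BB_zero[of c, OF BB_zero(3)]])
  next
    case (BB_distinct i j k l)
    show ?thesis
      unfolding BB_distinct
      by (rule h_eqI[OF h_BB_vcomm h_zero DR_rel.BB_distinct[OF BB_distinct(3)]])
  next
    case (BB_same i k l)
    have "h y = h (BB_rhs (\<lambda>s r. xTheta i r * xZ s * xK i) k l)"
      by (simp add: BB_same BB_rhs_def)
    also have "\<dots> = DR_shift c (BB_rhs (\<lambda>_ r. xK i * xZ (k + l + 1) * xTheta i r) k l) 0"
      by (intro h_BB_rhs h_Z_between_Theta(1)) simp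
    finally show ?thesis
      unfolding BB_same DR_BB_rhs[symmetric] by (rule h_eqI[OF h_BB_vcomm _ DR_rel.BB_same])
  next
    case (Serre i j k1 k2 l)
    have rhs: "h (Dr_rhs i j k1 k2 l) = DR_shift c (DR_rhs i j k1 k2 l) 0" for k1 k2
      unfolding Dr_rhs_eq DR_rhs_eq by (rule h_serre_rhs) simp_all
    show ?thesis
      unfolding Serre
      by (rule h_eqI[OF h_add[OF h_serre h_serre] h_add[OF rhs rhs] DR_rel.Serre[of c, OF Serre(3)]])
  qed
qed

section \<open>Maps to and from the tensor product\<close>

lemma Dr_half_alg_simps:
  fixes c :: "'i \<Rightarrow> 'i \<Rightarrow> int"
  defines "T \<equiv> tensor_ring (ring_of_type_algebra :: laurent ring) (Dr_laurent c) (Dr_alg c)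
      laurent_incl ring_of_type_algebra"
  shows "carrier (Dr_half_alg c) = carrier T"
    "x \<otimes>\<^bsub>Dr_half_alg c\<^esub> y = x \<otimes>\<^bsub>T\<^esub> y"
    "x \<oplus>\<^bsub>Dr_half_alg c\<^esub> y = x \<oplus>\<^bsub>T\<^esub> y"
    "\<one>\<^bsub>Dr_half_alg c\<^esub> = \<one>\<^bsub>T\<^esub>"
    "k \<odot>\<^bsub>Dr_half_alg c\<^esub> x = Dr_tensor c (coset (Dr_rel c) (scalar k)) 0 \<otimes>\<^bsub>T\<^esub> x"
  by (simp_all add: Dr_half_alg_def algebra_via_def T_def)

lemma Dr_laurent_single: "Dr_laurent c (Poly_Mapping.single n k) = coset (Dr_rel c) (scalar k * xZ n)"
  by (cases "k = 0") (simp_all add: Dr_laurent_def scalar_def)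

lemma laurent_incl_single: "laurent_incl (Poly_Mapping.single n k) = Poly_Mapping.single (2 * n) k"
  by (cases "k = 0") (simp_all add: laurent_incl_def)

abbreviation (input) half :: "('i \<Rightarrow> 'i \<Rightarrow> int) \<Rightarrow> 'i falg \<Rightarrow> int \<Rightarrow> ('i falg set \<times> laurent \<Rightarrow>\<^sub>0 int) set"
  where "half c x n \<equiv> Dr_tensor c (coset (Dr_rel c) x) n"

context
  fixes c :: "'i \<Rightarrow> 'i \<Rightarrow> int"
begin

interpretation tensor_factors "ring_of_type_algebra :: laurent ring" "Dr_laurent c" "Dr_alg c"
    laurent_incl "ring_of_type_algebra :: laurent ring"
  by (rule tensor_factors_Dr)

lemma half_closed: "half c x n \<in> carrier (Dr_half_alg c)"
  unfolding Dr_half_alg_simps Dr_tensor_def by (rule pure_closed) (simp_all add: Dr_alg_simps)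

lemma half_add: "half c (x + y) n = half c x n \<oplus>\<^bsub>Dr_half_alg c\<^esub> half c y n"
  unfolding Dr_half_alg_simps Dr_tensor_def Dr_alg_simps[symmetric]
  by (rule pure_add_left) (simp_all add: Dr_alg_simps)

lemma half_mult: "half c (x * y) (m + n) = half c x m \<otimes>\<^bsub>Dr_half_alg c\<^esub> half c y n"
  unfolding Dr_half_alg_simps Dr_tensor_def
  by (subst pure_mult) (simp_all add: Dr_alg_simps mult_single)

lemma half_one: "half c 1 0 = \<one>\<^bsub>Dr_half_alg c\<^esub>"
  using pure_one by (simp add: Dr_half_alg_simps Dr_tensor_def Dr_alg_simps)

lemma half_scalar: "half c (scalar k) 0 = k \<odot>\<^bsub>Dr_half_alg c\<^esub> \<one>\<^bsub>Dr_half_alg c\<^esub>"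
proof -
  have "k \<odot>\<^bsub>Dr_half_alg c\<^esub> \<one>\<^bsub>Dr_half_alg c\<^esub> = half c (scalar k) 0 \<otimes>\<^bsub>Dr_half_alg c\<^esub> half c 1 0"
    unfolding half_one Dr_half_alg_simps ..
  also have "\<dots> = half c (scalar k) 0"
    unfolding half_mult[symmetric] by simp
  finally show ?thesis ..
qed

text \<open>Moving \<open>C\<^sup>k\<close> across the tensor sign turns it into \<open>(C\<^sup>1\<^sup>/\<^sup>2)\<^sup>2\<^sup>k\<close>.\<close>

lemma half_shift: "half c (x * xZ k) n = half c x (n + 2 * k)"
proof -
  have "half c (x * xZ k) n =
      pure (Dr_laurent c (Poly_Mapping.single k 1) \<otimes>\<^bsub>Dr_alg c\<^esub> coset (Dr_rel c) x) (Poly_Mapping.single n 1)"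
    by (simp add: Dr_tensor_def Dr_laurent_single Dr_alg_simps scalar_one Dr_xZ_central)
  also have "\<dots> = pure (coset (Dr_rel c) x)
      (laurent_incl (Poly_Mapping.single k 1) \<otimes>\<^bsub>ring_of_type_algebra\<^esub> Poly_Mapping.single n 1)"
    by (rule pure_scalar) (simp_all add: Dr_alg_simps)
  finally show ?thesis
    by (simp add: Dr_tensor_def laurent_incl_single mult_single add.commute)
qed

lemma half_central:
  assumes "\<And>y. coset (Dr_rel c) (x * y) = coset (Dr_rel c) (y * x)" "Y \<in> carrier (Dr_half_alg c)"
  shows "half c x n \<otimes>\<^bsub>Dr_half_alg c\<^esub> Y = Y \<otimes>\<^bsub>Dr_half_alg c\<^esub> half c x n"
  using assms(2) unfolding Dr_half_alg_simps Dr_tensor_def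
  by (intro pure_tensor_central) (auto simp: Dr_alg_simps assms(1) mult.commute)

text \<open>
  Scalars can be moved into the first factor, so the tensors of the form \<open>x \<otimes> C\<^sup>n\<^sup>/\<^sup>2\<close> generate
  the tensor product additively.
\<close>

lemma half_alg_hom_eqI:
  assumes "ring D" "f \<in> ring_hom (Dr_half_alg c) D" "g \<in> ring_hom (Dr_half_alg c) D"
    and "\<And>x n. f (half c x n) = g (half c x n)" and "Y \<in> carrier (Dr_half_alg c)"
  shows "f Y = g Y"
proof -
  interpret D: ring D by fact
  have hom: "f \<in> ring_hom T D" "g \<in> ring_hom T D"
    using assms(2,3) by (simp_all add: ring_hom_def Dr_half_alg_simps)
  interpret f: ring_hom_ring T D f
    by (intro ring_hom_ringI2 ring_tensor_ring assms(1) hom)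
  interpret g: ring_hom_ring T D g
    by (intro ring_hom_ringI2 ring_tensor_ring assms(1) hom)
  have "Y \<in> carrier T"
    using assms(5) by (simp add: Dr_half_alg_simps)
  then show ?thesis
  proof (induction Y rule: tensor_induct)
    case (pure y r)
    then obtain x where x: "y = coset (Dr_rel c) x"
      by (auto simp: Dr_alg_simps)
    show ?case
    proof (induction r rule: poly_mapping_monomial_induct)
      case (1 n k)
      have "pure y (Poly_Mapping.single n k) =
          pure y (laurent_incl (Poly_Mapping.single 0 k) \<otimes>\<^bsub>ring_of_type_algebra\<^esub> Poly_Mapping.single n 1)"
        by (simp add: laurent_incl_single mult_single)
      also have "\<dots> = half c (scalar k * x) n"
        unfolding Dr_tensor_def
        by (subst pure_scalar[symmetric]) (simp_all add: x Dr_laurent_single Dr_alg_simps xZ_zero)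
      finally show ?case
        by (simp add: assms(4))
    next
      case (2 r s)
      then show ?case
        using pure_add_right[OF pure(1), of r s] pure_closed[OF pure(1)] by simp
    qed
  next
    case (diff U V)
    then show ?case by (simp add: a_minus_def)
  qed
qed

text \<open>
  The second factor maps to \<^const>\<open>DR_alg\<close> by evaluating Laurent polynomials at \<open>C\<^sup>1\<^sup>/\<^sup>2\<close>, with
  central values. The assumptions on \<open>G\<close> say that this agrees with \<open>G\<close> on Laurent polynomials in \<open>C\<close>.
\<close>

lemma half_to_DR_exists:
  assumes "G \<in> ring_hom (Dr_alg c) (DR_alg c)"
    and G_scalar: "\<And>k. G (coset (Dr_rel c) (scalar k)) = coset (DR_rel c) (scalar k)"
    and G_Z: "\<And>n. G (coset (Dr_rel c) (xZ n)) = coset (DR_rel c) (xZ (2 * n))"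
  obtains \<psi> where "\<psi> \<in> ring_hom (Dr_half_alg c) (DR_alg c)"
    "\<And>x n. \<psi> (half c x n) = G (coset (Dr_rel c) x) \<otimes>\<^bsub>DR_alg c\<^esub> coset (DR_rel c) (xZ n)"
proof -
  interpret DR: assoc_algebra "ring_of_type_algebra :: qv ring" "DR_alg c"
    by (rule assoc_algebra_DR)
  interpret L: monoid_algebra_rep "DR_alg c" "\<lambda>n. coset (DR_rel c) (xZ n)"
    by unfold_locales (simp_all add: DR_alg_simps xZ_zero DR_Z_add)
  note G = ring_hom_closed[OF assms(1)] ring_hom_add[OF assms(1)] ring_hom_mult[OF assms(1)]
  have E_single: "L.extend (Poly_Mapping.single n k) = coset (DR_rel c) (scalar k * xZ n)" for n k
    by (simp add: L.extend_single DR_alg_simps)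
  have E_central: "y \<otimes>\<^bsub>DR_alg c\<^esub> L.extend f = L.extend f \<otimes>\<^bsub>DR_alg c\<^esub> y" if y: "y \<in> carrier (DR_alg c)" for y f
  proof (induction f rule: poly_mapping_monomial_induct)
    case (1 n k)
    obtain z where z: "y = coset (DR_rel c) z"
      using y by (auto simp: DR_alg_simps)
    have "coset (DR_rel c) (z * (scalar k * xZ n)) = coset (DR_rel c) (scalar k * (z * xZ n))"
      by (simp only: mult.assoc[symmetric] scalar_central[of k z])
    also have "\<dots> = coset (DR_rel c) (scalar k * (xZ n * z))"
      by (intro coset_mult_cong refl DR_Z_central[symmetric])
    finally show ?case
      by (simp add: z E_single DR_alg_simps mult.assoc)
  qed (simp add: L.extend_add L.extend_closed y DR.A.l_distr DR.A.r_distr)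
  have agree: "G (Dr_laurent c r) = L.extend (laurent_incl r)" for r
  proof (induction r rule: poly_mapping_monomial_induct)
    case (1 n k)
    have "G (coset (Dr_rel c) (scalar k * xZ n)) =
        G (coset (Dr_rel c) (scalar k)) \<otimes>\<^bsub>DR_alg c\<^esub> G (coset (Dr_rel c) (xZ n))"
      unfolding Dr_alg_simps(2)[symmetric] by (rule G(3)) (simp_all add: Dr_alg_simps)
    then show ?case
      by (simp add: Dr_laurent_single laurent_incl_single E_single G_scalar G_Z DR_alg_simps)
  next
    case (2 r s)
    have closed: "Dr_laurent c r \<in> carrier (Dr_alg c)" for r
      using ring_hom_closed[OF Dr_laurent_hom] by simp
    show ?case
      using ring_hom_add[OF Dr_laurent_hom, of r s c] ring_hom_add[OF laurent_incl_hom, of r s] 2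
      by (simp add: G(2) closed L.extend_add)
  qed
  obtain \<psi> where \<psi>: "\<psi> \<in> ring_hom T (DR_alg c)"
    "\<And>x f. x \<in> carrier (Dr_alg c) \<Longrightarrow> f \<in> carrier ring_of_type_algebra \<Longrightarrow>
      \<psi> (pure x f) = G x \<otimes>\<^bsub>DR_alg c\<^esub> L.extend f"
    using tensor_hom_exists[OF DR.A.ring_axioms assms(1) L.extend_hom E_central[OF G(1)] agree]
    by blast
  have "\<psi> \<in> ring_hom (Dr_half_alg c) (DR_alg c)"
    using \<psi>(1) by (simp add: ring_hom_def Dr_half_alg_simps)
  then show ?thesis
    by (rule that) (simp add: Dr_tensor_def \<psi>(2) E_single Dr_alg_simps scalar_one)
qed

end

lemma DR_to_half_rescaling:
  assumes "h \<in> ring_hom ring_of_type_algebra (Dr_half_alg c)"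
    and "\<And>g. h (letter g) = gen_image (half c) 1 (-1) g"
    and "\<And>k. h (scalar k) = k \<odot>\<^bsub>Dr_half_alg c\<^esub> \<one>\<^bsub>Dr_half_alg c\<^esub>"
  shows "rescaling (Dr_half_alg c) (Dr_rel c) (half c) 1 2 (-1) h"
proof (intro rescaling.intro rescaling_axioms.intro assoc_algebra_Dr_half assms
    half_closed half_add half_mult half_shift half_scalar)
  show "Dr_rel c x y \<Longrightarrow> half c x n = half c y n" for x y n
    by (simp add: coset_eqI)
  show "half c (xZ k * x) n = half c (x * xZ k) n" for k x n
    by (simp add: Dr_xZ_central)
  show "half c (xK i * x) n = half c (x * xK i) n" for i x n
    using coset_eqI[of "Dr_rel c", OF Dr_rel.K_central[of c i x]] by simp
qed

lemma DR_to_half_respects_relations: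
  assumes h: "h \<in> ring_hom ring_of_type_algebra (Dr_half_alg c)"
    "\<And>g. h (letter g) = gen_image (half c) 1 (-1) g"
    "\<And>k. h (scalar k) = k \<odot>\<^bsub>Dr_half_alg c\<^esub> \<one>\<^bsub>Dr_half_alg c\<^esub>"
    and "DR_rel c x y"
  shows "h x = h y"
proof -
  interpret rescaling "Dr_half_alg c" "Dr_rel c" "half c" 1 2 "-1" h
    by (rule DR_to_half_rescaling[OF h])
  show ?thesis
    using assms(4)
  proof cases
    case (K_central i z)
    show ?thesis
      using half_central[of c "xK i" "h z" 0] coset_eqI[of "Dr_rel c", OF Dr_rel.K_central[of c i]]
      by (simp add: K_central h_mult_eq h_K h_closed)
  next
    case (C_central z)
    show ?thesis
      using half_central[of c 1 "h z"] by (simp add: C_central h_mult_eq h_Z h_closed)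
  next
    case (C_inv_central z)
    show ?thesis
      using half_central[of c 1 "h z"] by (simp add: C_inv_central h_mult_eq h_Z h_closed)
  next
    case (HH m n i j)
    then show ?thesis
      using h_eqI[OF h_HH h_zero Dr_rel.HH] by simp
  next
    case (K_inverse i)
    show ?thesis
      unfolding K_inverse
      by (rule h_eqI[OF h_mult[OF h_K h_K_inv refl] _ Dr_rel.K_inverse])
        (simp add: h_one_eq half_one)
  next
    case C_inverse
    show ?thesis
      using h_mult[OF h_Z h_Z refl, of 1 "-1"] by (simp add: C_inverse h_one_eq half_one)
  next
    case (HB m i j l)
    show ?thesis
      using h_HB(2)[of m 0 "- int m" "int m" "int m" "vint (int m * c i j) / of_nat m" j l] HB(3)
      unfolding HB(1,2) xZ_zero mult_1_right
      by (intro h_eqI[OF h_HB(1)[of m 0 "- int m" "int m" "int m"] _ Dr_rel.HB[OF HB(3)]]) simp_all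
  next
    case (BB_zero i j k l)
    show ?thesis
      unfolding BB_zero
      by (rule h_eqI[OF h_BB_comm h_zero Dr_rel.BB_zero[of c, OF BB_zero(3)]])
  next
    case (BB_distinct i j k l)
    show ?thesis
      unfolding BB_distinct
      by (rule h_eqI[OF h_BB_vcomm h_zero Dr_rel.BB_distinct[OF BB_distinct(3)]])
  next
    case (BB_same i k l)
    have "h y = h (BB_rhs (\<lambda>_ r. xK i * xZ (k + l + 1) * xTheta i r) k l)"
      by (simp only: BB_same DR_BB_rhs)
    also have "\<dots> = half c (BB_rhs (\<lambda>s r. xTheta i r * xZ s * xK i) k l) 0"
      by (intro h_BB_rhs h_Z_between_Theta(2)) simp
    finally show ?thesis
      unfolding BB_same BB_rhs_def by (rule h_eqI[OF h_BB_vcomm _ Dr_rel.BB_same])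
  next
    case (Serre i j k1 k2 l)
    have rhs: "h (DR_rhs i j k1 k2 l) = half c (Dr_rhs i j k1 k2 l) 0" for k1 k2
      unfolding Dr_rhs_eq DR_rhs_eq by (rule h_serre_rhs) simp_all
    show ?thesis
      unfolding Serre
      by (rule h_eqI[OF h_add[OF h_serre h_serre] h_add[OF rhs rhs] Dr_rel.Serre[of c, OF Serre(3)]])
  qed
qed

section \<open>The isomorphism\<close>

theorem proposition5p3:
  fixes c :: "'i \<Rightarrow> 'i \<Rightarrow> int"
  assumes "is_ade_cartan c"
  shows "\<exists>\<phi> \<in> algebra_iso (ring_of_type_algebra :: qv ring) (DR_alg c) (Dr_half_alg c).
    (\<forall>i m. m \<ge> 1 \<longrightarrow> \<phi> (coset (DR_rel c) (xH i m))
                      = Dr_tensor c (coset (Dr_rel c) (xH i m)) (- int m)) \<and>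
    (\<forall>i m. m \<ge> 1 \<longrightarrow> \<phi> (coset (DR_rel c) (xTheta i (int m)))
                      = Dr_tensor c (coset (Dr_rel c) (xTheta i (int m))) (- int m)) \<and>
    (\<forall>i. \<phi> (coset (DR_rel c) (xK i)) = Dr_tensor c (coset (Dr_rel c) (xK i)) 0) \<and>
    (\<forall>i. \<phi> (coset (DR_rel c) (xK_inv i)) = Dr_tensor c (coset (Dr_rel c) (xK_inv i)) 0) \<and>
    \<phi> (coset (DR_rel c) (xZ 1)) = Dr_tensor c (coset (Dr_rel c) 1) 1 \<and>
    \<phi> (coset (DR_rel c) (xZ (-1))) = Dr_tensor c (coset (Dr_rel c) 1) (-1) \<and>
    (\<forall>i l. \<phi> (coset (DR_rel c) (xB i l)) = Dr_tensor c (coset (Dr_rel c) (xB i l)) 0)"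
proof -
  interpret DR: assoc_algebra "ring_of_type_algebra :: qv ring" "DR_alg c"
    by (rule assoc_algebra_DR)
  interpret half: assoc_algebra "ring_of_type_algebra :: qv ring" "Dr_half_alg c"
    by (rule assoc_algebra_Dr_half)

  \<comment> \<open>From the second presentation: \<open>H\<^sub>m\<close> goes to \<open>H\<^sub>m C\<^sup>-\<^sup>m\<^sup>/\<^sup>2\<close>.\<close>
  have "gen_image (half c) 1 (-1) g \<in> carrier (Dr_half_alg c)" for g
    by (simp add: gen_image_def half_closed split: gen.split)
  then obtain f where f: "f \<in> ring_hom ring_of_type_algebra (Dr_half_alg c)"
    "\<And>g. f (letter g) = gen_image (half c) 1 (-1) g"
    "\<And>k. f (scalar k) = k \<odot>\<^bsub>Dr_half_alg c\<^esub> \<one>\<^bsub>Dr_half_alg c\<^esub>"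
    using free_alg_hom_exists[OF assoc_algebra_Dr_half, of "gen_image (half c) 1 (-1)"] by blast
  interpret f: rescaling "Dr_half_alg c" "Dr_rel c" "half c" 1 2 "-1" f
    by (rule DR_to_half_rescaling[OF f])
  obtain \<phi> where \<phi>_hom: "\<phi> \<in> ring_hom (DR_alg c) (Dr_half_alg c)"
    and \<phi>: "\<And>x. \<phi> (coset (DR_rel c) x) = f x"
    using presented_algebra_hom_exists[OF half.A.ring_axioms f(1) DR_to_half_respects_relations[OF f]]
    unfolding DR_alg_def by blast

  \<comment> \<open>In the opposite direction: \<open>H\<^sub>m\<close> goes to \<open>H\<^sub>m C\<^sup>m\<^sup>/\<^sup>2\<close>.\<close>
  have "gen_image (DR_shift c) 2 1 g \<in> carrier (DR_alg c)" for g
    by (simp add: gen_image_def DR_alg_simps split: gen.split)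
  then obtain g where g: "g \<in> ring_hom ring_of_type_algebra (DR_alg c)"
    "\<And>x. g (letter x) = gen_image (DR_shift c) 2 1 x"
    "\<And>k. g (scalar k) = k \<odot>\<^bsub>DR_alg c\<^esub> \<one>\<^bsub>DR_alg c\<^esub>"
    using free_alg_hom_exists[OF assoc_algebra_DR, of "gen_image (DR_shift c) 2 1"] by blast
  interpret g: rescaling "DR_alg c" "DR_rel c" "DR_shift c" 2 1 1 g
    by (rule Dr_to_DR_rescaling[OF g])
  obtain G where G_hom: "G \<in> ring_hom (Dr_alg c) (DR_alg c)"
    and G: "\<And>x. G (coset (Dr_rel c) x) = g x"
    using presented_algebra_hom_exists[OF DR.A.ring_axioms g(1) Dr_to_DR_respects_relations[OF g]]
    unfolding Dr_alg_def by blast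
  have "G (coset (Dr_rel c) (scalar k)) = coset (DR_rel c) (scalar k)"
    "G (coset (Dr_rel c) (xZ n)) = coset (DR_rel c) (xZ (2 * n))" for k n
    by (simp_all add: G g.h_scalar g.h_Z xZ_zero)
  then obtain \<psi> where \<psi>_hom: "\<psi> \<in> ring_hom (Dr_half_alg c) (DR_alg c)"
    and \<psi>: "\<And>x n. \<psi> (half c x n) = g x \<otimes>\<^bsub>DR_alg c\<^esub> coset (DR_rel c) (xZ n)"
    using half_to_DR_exists[OF G_hom] unfolding G by blast

  \<comment> \<open>The opposite powers of \<open>C\<^sup>1\<^sup>/\<^sup>2\<close> cancel, so both composites are the identity.\<close>
  have \<psi>_half: "\<psi> (half c x n) = coset (DR_rel c) x" if "g x = DR_shift c x (- n)" for x n
  proof -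
    have "DR_shift c x (- n) \<otimes>\<^bsub>DR_alg c\<^esub> DR_shift c 1 n = DR_shift c (x * 1) (- n + n)"
      by (rule DR_shift_mult[symmetric])
    with that show ?thesis
      by (simp add: \<psi> xZ_zero)
  qed
  note \<psi>_simps = ring_hom_add[OF \<psi>_hom] ring_hom_mult[OF \<psi>_hom]
  have \<psi>_f: "\<psi> (f x) = coset (DR_rel c) x" for x
  proof (induction x rule: free_alg_induct)
    case (letter y)
    show ?case
    proof (cases y)
      case Z
      then show ?thesis
        by (simp add: f(2) gen_image_def \<psi> g.h_one_eq DR_alg_simps) (simp add: xZ_def)
    next
      case Z_inv
      then show ?thesis
        by (simp add: f(2) gen_image_def \<psi> g.h_one_eq DR_alg_simps) (simp add: xZ_def)
    qed (auto simp: f(2) g(2) gen_image_def add.commute intro!: \<psi>_half)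
  next
    case (scalar k)
    show ?case
      by (simp add: f.h_scalar \<psi>_half g.h_scalar)
  qed (simp_all add: f.h_add_eq f.h_mult_eq f.h_closed \<psi>_simps DR_alg_simps)
  have \<psi>_\<phi>: "\<psi> (\<phi> y) = y" if "y \<in> carrier (DR_alg c)" for y
    using that by (auto simp: DR_alg_simps \<phi> \<psi>_f)

  note \<phi>_simps = ring_hom_add[OF \<phi>_hom] ring_hom_mult[OF \<phi>_hom]
  have f_shift: "f (x * xZ n) = half c x 0" if "f x = half c x (- n)" for x n
    using f.h_Z_right[OF that, of 0 0 n] by (simp add: xZ_zero)
  have \<phi>_g: "\<phi> (g x) = half c x 0" for x
  proof (induction x rule: free_alg_induct)
    case (letter y)
    show ?case
    proof (cases y)
      case Z
      then show ?thesis
        using half_shift[of c 1 1 0] f.h_Z[of 2] by (simp add: g(2) gen_image_def \<phi> xZ_def)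
    next
      case Z_inv
      then show ?thesis
        using half_shift[of c 1 "-1" 0] f.h_Z[of "-2"] by (simp add: g(2) gen_image_def \<phi> xZ_def)
    qed (auto simp: f(2) g(2) gen_image_def \<phi> add.commute intro!: f_shift)
  next
    case (scalar k)
    show ?case
      by (simp add: g.h_scalar xZ_zero \<phi> f.h_scalar)
  next
    case (add x y)
    then show ?case
      by (simp add: g.h_add_eq g.h_closed \<phi>_simps half_add)
  next
    case (mult x y)
    then show ?case
      using half_mult[of c x y 0 0] by (simp add: g.h_mult_eq g.h_closed \<phi>_simps)
  qed
  have \<phi>_\<psi>: "\<phi> (\<psi> U) = U" if "U \<in> carrier (Dr_half_alg c)" for U
  proof -
    have id: "id \<in> ring_hom (Dr_half_alg c) (Dr_half_alg c)"
      by (simp add: ring_hom_def)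
    have agree: "(\<phi> \<circ> \<psi>) (half c x n) = id (half c x n)" for x n
    proof -
      have "coset (DR_rel c) (xZ n) \<in> carrier (DR_alg c)"
        by (simp add: DR_alg_simps)
      then have "\<phi> (\<psi> (half c x n)) = half c x 0 \<otimes>\<^bsub>Dr_half_alg c\<^esub> half c 1 n"
        using f.h_Z[of n] by (simp add: \<psi> \<phi>_simps g.h_closed \<phi>_g \<phi>)
      then show ?thesis
        by (simp flip: half_mult)
    qed
    show ?thesis
      using half_alg_hom_eqI[OF half.A.ring_axioms ring_hom_trans[OF \<psi>_hom \<phi>_hom] id agree that]
      by simp
  qed

  have "bij_betw \<phi> (carrier (DR_alg c)) (carrier (Dr_half_alg c))"
    using ring_hom_closed[OF \<phi>_hom] ring_hom_closed[OF \<psi>_hom] \<psi>_\<phi> \<phi>_\<psi>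
    by (intro bij_betw_byWitness[of _ \<psi>]) auto
  moreover have "\<phi> (k \<odot>\<^bsub>DR_alg c\<^esub> y) = k \<odot>\<^bsub>Dr_half_alg c\<^esub> \<phi> y" if "y \<in> carrier (DR_alg c)" for k y
  proof -
    obtain x where "y = coset (DR_rel c) x"
      using \<open>y \<in> carrier (DR_alg c)\<close> by (auto simp: DR_alg_simps)
    then show ?thesis
      using half.smult_mult_left[of k "\<one>\<^bsub>Dr_half_alg c\<^esub>" "f x"]
      by (simp add: DR_alg_simps \<phi> f.h_mult_eq f(3) f.h_closed)
  qed
  ultimately have "\<phi> \<in> algebra_iso ring_of_type_algebra (DR_alg c) (Dr_half_alg c)"
    using \<phi>_hom by (simp add: algebra_iso_def ring_iso_def)
  then show ?thesis
    by (rule bexI[rotated])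
      (simp add: \<phi> f.h_H f.h_Theta f.h_K f.h_K_inv f.h_B f.h_Z)
qed

end
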